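(* Let $n\ge1$ and let $T$ be any topological space. With the component spaces $E_n^T\binom{\psi}{\underline\varphi}$, identities, symmetric group actions and composition maps defined in the context, $E_n^T$ is a topological operad coloured over $\mathrm{Map}(\mathbb{S}^{n-1},T)$.
   Context: $\mathbb{D}^n$ is the closed unit ball in $\mathbb{R}^n$ and $\mathbb{S}^{n-1}$ its boundary. $E_n(r)$ is the space of maps $f:\coprod_{k=1}^r\mathbb{D}^n\to\mathbb{D}^n$ whose restriction $f_k$ to each disk is a rescaling composed with a translation and such that the interiors of the images of the $f_k$ are pairwise disjoint; $E_n$ is the little $n$-disks operad. $\mathsf{C}(f)$ is $\mathbb{D}^n$ minus the union of the open disks $f_k(\mathring{\mathbb{D}}^n)$. $W_n(r)=\{(f,x)\in E_n(r)\times\mathbb{D}^n: x\in\mathsf{C}(f)\}$. $W_n^T(r)$ is the set of pairs $\langle f,\xi\rangle$ with $f\in E_n(r)$ and $\xi:\mathsf{C}(f)\to T$ continuous, with the final topology with respect to all maps of sets $g:Y\to W_n^T(r)$, $y\mapsto\langle f_y,\xi_y\rangle$, from topological spaces $Y$ such that $y\mapsto f_y$ is continuous and $W_n(r)\times_{E_n(r)}Y\to T$, $(f_y,x,y)\mapsto\xi_y(x)$, is continuous. For maps $\varphi_1,\dots,\varphi_r,\psi:\mathbb{S}^{n-1}\to T$ and $\underline\varphi=(\varphi_1,\dots,\varphi_r)$, $E_n^T\binom{\psi}{\underline\varphi}\subset W_n^T(r)$ is the subspace of those $\langle f,\xi\rangle$ such that $\xi$ restricts to $\varphi_k$ on the $k$-th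 inner boundary sphere (parametrized by $f_k|_{\mathbb{S}^{n-1}}$) and to $\psi$ on the outer sphere $\mathbb{S}^{n-1}=\partial\mathbb{D}^n$. The identity in $E_n^T\binom{\varphi}{\varphi}$ is the identity embedding $I$ together with $\varphi:\mathsf{C}(I)=\mathbb{S}^{n-1}\to T$. The symmetric group actions come from the action of $\Sigma_r$ on $E_n(r)$. The composition $$E_n^T\binom{\psi}{\underline\varphi}\times\prod_{j=1}^rE_n^T\binom{\varphi_j}{\underline\lambda_j}\to E_n^T\binom{\psi}{\underline\lambda_1\otimes\dots\otimes\underline\lambda_r}$$ ($\otimes$ denotes juxtaposition of tuples) sends $(\langle f,\xi\rangle,\langle g_1,\mu_1\rangle,\dots,\langle g_r,\mu_r\rangle)$ to $\langle f\circ(g_1,\dots,g_r),\ \xi\cup\mu_1\cup\dots\cup\mu_r\rangle$, where $f\circ(g_1,\dots,g_r)$ is the composition in $E_n$ and $\mu_j$ (transported by $f_j$) is glued to $\xi$ along the $j$-th inner boundary sphere of $\mathsf{C}(f)$, on which both are given by $\varphi_j$. A topological operad requires in particular that all composition maps be continuous. *)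

theory Defs
  imports "HOL-Analysis.Analysis" "HOL-Combinatorics.Permutations"
begin

section \<open>Coloured topological operads\<close>

text \<open>
  Inputs are numbered from 0.  Given arities \<open>ns = [n\<^sub>0, \<dots>]\<close>, the inputs of a composite are
  numbered by concatenating the blocks: input number \<open>block_offset ns j + i\<close> of the composite is
  the \<open>i\<close>-th input of the \<open>j\<close>-th block, and \<open>block_index ns\<close> lists these pairs \<open>(j, i)\<close> in order.
\<close>

definition block_offset :: "nat list \<Rightarrow> nat \<Rightarrow> nat" where
  "block_offset ns j = sum_list (take j ns)"

definition block_index :: "nat list \<Rightarrow> (nat \<times> nat) list" where
  "block_index ns = concat (map (\<lambda>j. map (Pair j) [0..<ns ! j]) [0..<length ns])"

text \<open>
  \<open>block_perm \<sigma> ns\<close> permutes whole blocks: it is the permutation \<open>\<rho>\<close> such that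
  \<open>permute_list \<rho> (concat xss) = concat (permute_list \<sigma> xss)\<close> if \<open>map length xss = ns\<close>.
  \<open>block_sum_perm \<tau> ns\<close> is the direct sum of the permutations \<open>\<tau> j\<close> of the individual blocks.
\<close>

definition block_perm :: "(nat \<Rightarrow> nat) \<Rightarrow> nat list \<Rightarrow> nat \<Rightarrow> nat" where
  "block_perm \<sigma> ns k =
     (if k < sum_list ns
      then (case block_index (permute_list \<sigma> ns) ! k of (j, i) \<Rightarrow> block_offset ns (\<sigma> j) + i)
      else k)"

definition block_sum_perm :: "(nat \<Rightarrow> nat \<Rightarrow> nat) \<Rightarrow> nat list \<Rightarrow> nat \<Rightarrow> nat" where
  "block_sum_perm \<tau> ns k =
     (if k < sum_list ns
      then (case block_index ns ! k of (j, i) \<Rightarrow> block_offset ns j + \<tau> j i)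
      else k)"

text \<open>
  \<open>P c ds\<close> is the space of operations with inputs coloured by \<open>ds\<close> and output coloured by \<open>c\<close>.
  The composite \<open>comp c ds ess p q\<close> plugs the operation \<open>q j\<close> in \<open>P (ds ! j) (ess ! j)\<close> into the
  \<open>j\<close>-th input of \<open>p\<close> in \<open>P c ds\<close>.  The symmetric groups act from the right, the \<open>k\<close>-th
  input of \<open>act c ds \<sigma> p\<close> being the input number \<open>\<sigma> k\<close> of \<open>p\<close>.  The structure maps receive the colours
  as arguments because the spaces \<open>P c ds\<close> are not assumed to be disjoint.  The colours form a set,
  without a topology.
\<close>

locale coloured_topological_operad =
  fixes C :: "'c set"
    and P :: "'c \<Rightarrow> 'c list \<Rightarrow> 'p topology"
    and ident :: "'c \<Rightarrow> 'p"
    and act :: "'c \<Rightarrow> 'c list \<Rightarrow> (nat \<Rightarrow> nat) \<Rightarrow> 'p \<Rightarrow> 'p"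
    and comp :: "'c \<Rightarrow> 'c list \<Rightarrow> 'c list list \<Rightarrow> 'p \<Rightarrow> (nat \<Rightarrow> 'p) \<Rightarrow> 'p"
  assumes ident_in: "c \<in> C \<Longrightarrow> ident c \<in> topspace (P c [c])"
    and continuous_act:
      "\<lbrakk>c \<in> C; ds \<in> lists C; \<sigma> permutes {..<length ds}\<rbrakk>
       \<Longrightarrow> continuous_map (P c ds) (P c (permute_list \<sigma> ds)) (act c ds \<sigma>)"
    and continuous_comp:
      "\<lbrakk>c \<in> C; ds \<in> lists C; ess \<in> lists (lists C); length ess = length ds\<rbrakk>
       \<Longrightarrow> continuous_map
             (prod_topology (P c ds)
               (product_topology (\<lambda>j. P (ds ! j) (ess ! j)) {..<length ds}))
             (P c (concat ess)) (\<lambda>(p, q). comp c ds ess p q)"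
    and act_id:
      "\<lbrakk>c \<in> C; ds \<in> lists C; p \<in> topspace (P c ds)\<rbrakk> \<Longrightarrow> act c ds id p = p"
    and act_act:
      "\<lbrakk>c \<in> C; ds \<in> lists C; \<sigma> permutes {..<length ds}; \<tau> permutes {..<length ds};
        p \<in> topspace (P c ds)\<rbrakk>
       \<Longrightarrow> act c ds (\<sigma> \<circ> \<tau>) p = act c (permute_list \<sigma> ds) \<tau> (act c ds \<sigma> p)"
    and comp_ident_left:
      "\<lbrakk>c \<in> C; es \<in> lists C; p \<in> topspace (P c es)\<rbrakk>
       \<Longrightarrow> comp c [c] [es] (ident c) (\<lambda>j\<in>{..<1}. p) = p"
    and comp_ident_right:
      "\<lbrakk>c \<in> C; ds \<in> lists C; p \<in> topspace (P c ds)\<rbrakk>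
       \<Longrightarrow> comp c ds (map (\<lambda>d. [d]) ds) p (\<lambda>j\<in>{..<length ds}. ident (ds ! j)) = p"
    and comp_assoc:
      "\<lbrakk>c \<in> C; ds \<in> lists C; ess \<in> lists (lists C); fsss \<in> lists (lists (lists C));
        length ess = length ds; map length fsss = map length ess;
        p \<in> topspace (P c ds);
        q \<in> topspace (product_topology (\<lambda>j. P (ds ! j) (ess ! j)) {..<length ds});
        s \<in> topspace (product_topology (\<lambda>k. P (concat ess ! k) (concat fsss ! k))
              {..<length (concat ess)})\<rbrakk>
       \<Longrightarrow> comp c (concat ess) (concat fsss) (comp c ds ess p q) s =
           comp c ds (map concat fsss) p
             (\<lambda>j\<in>{..<length ds}. comp (ds ! j) (ess ! j) (fsss ! j) (q j)
                (\<lambda>i\<in>{..<length (ess ! j)}. s (block_offset (map length ess) j + i)))"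
    and comp_act_left:
      "\<lbrakk>c \<in> C; ds \<in> lists C; ess \<in> lists (lists C); length ess = length ds;
        \<sigma> permutes {..<length ds};
        p \<in> topspace (P c ds);
        q \<in> topspace (product_topology (\<lambda>j. P (ds ! j) (ess ! j)) {..<length ds})\<rbrakk>
       \<Longrightarrow> comp c (permute_list \<sigma> ds) (permute_list \<sigma> ess) (act c ds \<sigma> p)
             (\<lambda>j\<in>{..<length ds}. q (\<sigma> j)) =
           act c (concat ess) (block_perm \<sigma> (map length ess)) (comp c ds ess p q)"
    and comp_act_right:
      "\<lbrakk>c \<in> C; ds \<in> lists C; ess \<in> lists (lists C); length ess = length ds;
        \<forall>j<length ds. \<tau>s j permutes {..<length (ess ! j)};
        p \<in> topspace (P c ds);
        q \<in> topspace (product_topology (\<lambda>j. P (ds ! j) (ess ! j)) {..<length ds})\<rbrakk>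
       \<Longrightarrow> comp c ds (map (\<lambda>j. permute_list (\<tau>s j) (ess ! j)) [0..<length ds]) p
             (\<lambda>j\<in>{..<length ds}. act (ds ! j) (ess ! j) (\<tau>s j) (q j)) =
           act c (concat ess) (block_sum_perm \<tau>s (map length ess)) (comp c ds ess p q)"


section \<open>The little disks operad\<close>

definition compact_open :: "'a topology \<Rightarrow> 'b topology \<Rightarrow> ('a \<Rightarrow> 'b) topology" where
  "compact_open X Y = topology_generated_by
     {{f \<in> extensional (topspace X). continuous_map X Y f \<and> f ` K \<subseteq> U} | K U.
        compactin X K \<and> openin Y U}"

text \<open>
  A configuration is a map from the disjoint union of \<open>r\<close> copies of the closed unit disk; its
  restriction to the \<open>k\<close>-th copy is \<open>\<lambda>x. f (k, x)\<close>.
\<close>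

type_synonym 'a config = "nat \<times> 'a \<Rightarrow> 'a"

definition little_disks :: "nat \<Rightarrow> ('a::euclidean_space) config topology" where
  "little_disks r =
     subtopology
       (compact_open (sum_topology (\<lambda>k. top_of_set (cball 0 1)) {..<r}) (top_of_set (cball 0 1)))
       {f. (\<forall>k<r. \<exists>a>0. \<exists>c. \<forall>x\<in>cball 0 1. f (k, x) = a *\<^sub>R x + c) \<and>
           pairwise (\<lambda>k l. disjnt (interior ((\<lambda>x. f (k, x)) ` cball 0 1))
                                  (interior ((\<lambda>x. f (l, x)) ` cball 0 1))) {..<r}}"

definition little_disks_id :: "('a::euclidean_space) config" where
  "little_disks_id = (\<lambda>(k, x)\<in>{..<1} \<times> cball 0 1. x)"

definition little_disks_act ::
  "nat \<Rightarrow> (nat \<Rightarrow> nat) \<Rightarrow> ('a::euclidean_space) config \<Rightarrow> 'a config" where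
  "little_disks_act r \<sigma> f = (\<lambda>(k, x)\<in>{..<r} \<times> cball 0 1. f (\<sigma> k, x))"

text \<open>\<open>ns ! j\<close> is the arity of \<open>g j\<close>.\<close>

definition little_disks_comp ::
  "nat list \<Rightarrow> ('a::euclidean_space) config \<Rightarrow> (nat \<Rightarrow> 'a config) \<Rightarrow> 'a config" where
  "little_disks_comp ns f g =
     (\<lambda>(k, x)\<in>{..<sum_list ns} \<times> cball 0 1.
        case block_index ns ! k of (j, i) \<Rightarrow> f (j, g j (i, x)))"

definition disk_complement :: "nat \<Rightarrow> ('a::euclidean_space) config \<Rightarrow> 'a set" where
  "disk_complement r f = cball 0 1 - (\<Union>k<r. (\<lambda>x. f (k, x)) ` ball 0 1)"


section \<open>The spaces \<open>W\<^sub>n(r)\<close> and \<open>W\<^sub>n\<^sup>T(r)\<close>\<close>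

definition W_space :: "nat \<Rightarrow> (('a::euclidean_space) config \<times> 'a) topology" where
  "W_space r =
     subtopology (prod_topology (little_disks r) (top_of_set (cball 0 1)))
       {(f, x). x \<in> disk_complement r f}"

definition WT_points ::
  "nat \<Rightarrow> 't topology \<Rightarrow> (('a::euclidean_space) config \<times> ('a \<Rightarrow> 't)) set" where
  "WT_points r T =
     {(f, \<xi>). f \<in> topspace (little_disks r) \<and> \<xi> \<in> extensional (disk_complement r f) \<and>
        continuous_map (top_of_set (disk_complement r f)) T \<xi>}"

definition WT_test_map ::
  "nat \<Rightarrow> 't topology \<Rightarrow> 'y topology \<Rightarrow> ('y \<Rightarrow> ('a::euclidean_space) config \<times> ('a \<Rightarrow> 't)) \<Rightarrow> bool" where
  "WT_test_map r T Y g \<longleftrightarrow>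
     g \<in> topspace Y \<rightarrow> WT_points r T \<and>
     continuous_map Y (little_disks r) (\<lambda>y. fst (g y)) \<and>
     continuous_map
       (subtopology (prod_topology (W_space r) Y) {((f, x), y). f = fst (g y)}) T
       (\<lambda>((f, x), y). snd (g y) x)"

text \<open>
  The final topology with respect to all test maps.  HOL cannot quantify over the type of points
  of \<open>Y\<close> inside a definition, so \<open>Y\<close> ranges over the topologies on subsets of the type of points of
  \<open>W\<^sub>n\<^sup>T(r)\<close> itself.  This is no restriction: by the lemma \<open>continuous_map_WT_test_map\<close> below, test
  maps out of spaces of every other type are continuous as well.
\<close>

definition WT_space ::
  "nat \<Rightarrow> 't topology \<Rightarrow> (('a::euclidean_space) config \<times> ('a \<Rightarrow> 't)) topology" where
  "WT_space r T = topology (\<lambda>U. U \<subseteq> WT_points r T \<and>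
     (\<forall>(Y :: ('a config \<times> ('a \<Rightarrow> 't)) topology) g.
        WT_test_map r T Y g \<longrightarrow> openin Y {y \<in> topspace Y. g y \<in> U}))"

lemma openin_WT_space:
  fixes T :: "'t topology" and U :: "(('a::euclidean_space) config \<times> ('a \<Rightarrow> 't)) set"
  shows "openin (WT_space r T) U \<longleftrightarrow> U \<subseteq> WT_points r T \<and>
     (\<forall>(Y :: ('a config \<times> ('a \<Rightarrow> 't)) topology) g.
        WT_test_map r T Y g \<longrightarrow> openin Y {y \<in> topspace Y. g y \<in> U})"
proof -
  have "istopology (\<lambda>U :: ('a config \<times> ('a \<Rightarrow> 't)) set. U \<subseteq> WT_points r T \<and>
     (\<forall>(Y :: ('a config \<times> ('a \<Rightarrow> 't)) topology) g.
        WT_test_map r T Y g \<longrightarrow> openin Y {y \<in> topspace Y. g y \<in> U}))"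
    unfolding istopology_def
  proof (intro conjI allI impI)
    fix S S' :: "('a config \<times> ('a \<Rightarrow> 't)) set" and Y :: "('a config \<times> ('a \<Rightarrow> 't)) topology"
      and g :: "'a config \<times> ('a \<Rightarrow> 't) \<Rightarrow> 'a config \<times> ('a \<Rightarrow> 't)"
    assume S: "S \<subseteq> WT_points r T \<and>
         (\<forall>(Y :: ('a config \<times> ('a \<Rightarrow> 't)) topology) g.
           WT_test_map r T Y g \<longrightarrow> openin Y {y \<in> topspace Y. g y \<in> S})"
      and S': "S' \<subseteq> WT_points r T \<and>
         (\<forall>(Y :: ('a config \<times> ('a \<Rightarrow> 't)) topology) g.
           WT_test_map r T Y g \<longrightarrow> openin Y {y \<in> topspace Y. g y \<in> S'})"
    show "S \<inter> S' \<subseteq> WT_points r T" using S by blast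
    assume g: "WT_test_map r T Y g"
    have "{y \<in> topspace Y. g y \<in> S \<inter> S'} = {y \<in> topspace Y. g y \<in> S} \<inter> {y \<in> topspace Y. g y \<in> S'}"
      by blast
    then show "openin Y {y \<in> topspace Y. g y \<in> S \<inter> S'}" using S S' g by auto
  next
    fix \<K> :: "('a config \<times> ('a \<Rightarrow> 't)) set set" and Y :: "('a config \<times> ('a \<Rightarrow> 't)) topology"
      and g :: "'a config \<times> ('a \<Rightarrow> 't) \<Rightarrow> 'a config \<times> ('a \<Rightarrow> 't)"
    assume K: "\<forall>S\<in>\<K>. S \<subseteq> WT_points r T \<and>
         (\<forall>(Y :: ('a config \<times> ('a \<Rightarrow> 't)) topology) g.
           WT_test_map r T Y g \<longrightarrow> openin Y {y \<in> topspace Y. g y \<in> S})"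
    show "\<Union> \<K> \<subseteq> WT_points r T" using K by blast
    assume g: "WT_test_map r T Y g"
    have "{y \<in> topspace Y. g y \<in> \<Union> \<K>} = (\<Union>S\<in>\<K>. {y \<in> topspace Y. g y \<in> S})"
      by blast
    moreover have "openin Y \<dots>"
      using K g by blast
    ultimately show "openin Y {y \<in> topspace Y. g y \<in> \<Union> \<K>}" by simp
  qed
  then show ?thesis
    unfolding WT_space_def by (simp only: topology_inverse')
qed

lemma topspace_WT_space [simp]:
  fixes T :: "'t topology"
  shows "topspace (WT_space r T) =
    (WT_points r T :: (('a::euclidean_space) config \<times> ('a \<Rightarrow> 't)) set)" (is "topspace ?W = ?P")
proof
  show "topspace ?W \<subseteq> ?P"
    using openin_topspace openin_WT_space by blast
  have "{y \<in> topspace Y. g y \<in> ?P} = topspace Y"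
    if "WT_test_map r T Y g" for Y :: "('a config \<times> ('a \<Rightarrow> 't)) topology"
      and g :: "'a config \<times> ('a \<Rightarrow> 't) \<Rightarrow> 'a config \<times> ('a \<Rightarrow> 't)"
    using that by (auto simp: WT_test_map_def)
  then have "openin ?W ?P"
    by (simp add: openin_WT_space)
  then show "?P \<subseteq> topspace ?W"
    by (rule openin_subset)
qed

lemma topspace_compact_open:
  "topspace (compact_open X Y) = {f \<in> extensional (topspace X). continuous_map X Y f}"
proof -
  have "{f \<in> extensional (topspace X). continuous_map X Y f} \<in>
     {{f \<in> extensional (topspace X). continuous_map X Y f \<and> f ` K \<subseteq> U} | K U.
        compactin X K \<and> openin Y U}"
    by (intro CollectI exI [of _ "{}"]) auto
  then show ?thesis
    unfolding compact_open_def topology_generated_by_topspace by blast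
qed

lemma little_disksD:
  assumes "f \<in> topspace (little_disks r)" "k < r"
  shows "\<exists>a>0. \<exists>c. \<forall>x\<in>cball 0 1. f (k, x) = a *\<^sub>R x + c"
  using assms unfolding little_disks_def by auto

lemma continuous_map_little_disks_eval:
  fixes z :: "'a::euclidean_space"
  assumes "k < r" "z \<in> cball 0 1"
  shows "continuous_map (little_disks r) euclidean (\<lambda>f. f (k, z))"
proof -
  let ?X = "sum_topology (\<lambda>k. top_of_set (cball (0::'a) 1)) {..<r}"
  let ?Y = "top_of_set (cball (0::'a) 1)"
  have z: "(k, z) \<in> topspace ?X" using assms by simp
  have "continuous_map (compact_open ?X ?Y) ?Y (\<lambda>f. f (k, z))"
    unfolding continuous_map
  proof (intro conjI allI impI)
    show "(\<lambda>f. f (k, z)) ` topspace (compact_open ?X ?Y) \<subseteq> topspace ?Y"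
      using z unfolding topspace_compact_open continuous_map_def by blast
    fix U assume "openin ?Y U"
    moreover have "compactin ?X {(k, z)}" using z by simp
    ultimately have "openin (compact_open ?X ?Y)
        {f \<in> extensional (topspace ?X). continuous_map ?X ?Y f \<and> f ` {(k, z)} \<subseteq> U}"
      unfolding compact_open_def by (intro topology_generated_by_Basis) blast
    then show "openin (compact_open ?X ?Y) {f \<in> topspace (compact_open ?X ?Y). f (k, z) \<in> U}"
      by (simp add: topspace_compact_open conj_assoc)
  qed
  then show ?thesis
    unfolding little_disks_def
    by (intro continuous_map_from_subtopology) (auto simp: continuous_map_in_subtopology)
qed

lemma closedin_W_space:
  "closedin (prod_topology (little_disks r) (top_of_set (cball 0 1)))
     {p \<in> topspace (prod_topology (little_disks r) (top_of_set (cball (0::'a::euclidean_space) 1))).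
        snd p \<in> disk_complement r (fst p)}"
proof -
  let ?Z = "prod_topology (little_disks r) (top_of_set (cball (0::'a) 1))"
  obtain e :: 'a where e: "norm e = 1" by (metis norm_Basis nonempty_Basis ex_in_conv)
  define h where "h = (\<lambda>k (p :: 'a config \<times> 'a).
    norm (fst p (k, e) - fst p (k, 0)) - norm (snd p - fst p (k, 0)))"
  have op: "openin ?Z {p \<in> topspace ?Z. h k p \<in> {0<..}}" if "k < r" for k
  proof (rule openin_continuous_map_preimage [of _ euclideanreal])
    have 1: "continuous_map ?Z euclidean (\<lambda>p. fst p (k, z))" if "z \<in> cball 0 1" for z
      using continuous_map_compose [OF continuous_map_fst
          continuous_map_little_disks_eval [OF \<open>k < r\<close> that]]
      by (simp add: o_def)
    have 2: "continuous_map ?Z euclidean snd"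
      using continuous_map_snd [of "little_disks r" "top_of_set (cball (0::'a) 1)"]
      using continuous_map_into_fulltopology by blast
    show "continuous_map ?Z euclideanreal (h k)"
      unfolding h_def
      by (intro continuous_intros 1 2 continuous_map_norm continuous_map_diff) (auto simp: e)
  qed auto
  have iff: "x \<in> (\<lambda>x. f (k, x)) ` ball 0 1 \<longleftrightarrow> h k (f, x) > 0"
    if f: "f \<in> topspace (little_disks r)" and "k < r" for f x k
  proof -
    obtain a c where a: "a > 0" and eq: "\<And>x. x \<in> cball 0 1 \<Longrightarrow> f (k, x) = a *\<^sub>R x + c"
      using little_disksD [OF f \<open>k < r\<close>] by blast
    have h: "h k (f, x) = a - norm (x - c)"
      using a e by (simp add: h_def eq)
    show ?thesis
    proof
      assume "x \<in> (\<lambda>x. f (k, x)) ` ball 0 1"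
      then obtain y where "norm y < 1" "x = a *\<^sub>R y + c"
        using eq by force
      then have "norm (x - c) = a * norm y" "a * norm y < a" using a by simp_all
      then show "h k (f, x) > 0" unfolding h by linarith
    next
      assume "h k (f, x) > 0"
      then have n: "norm (x - c) < a" by (simp add: h)
      define y where "y = (x - c) /\<^sub>R a"
      have "norm y = norm (x - c) / a"
        using a unfolding y_def norm_scaleR by (simp add: divide_inverse)
      then have "norm y < 1" using n a by simp
      moreover have "f (k, y) = x" using \<open>norm y < 1\<close> a by (simp add: eq) (simp add: y_def)
      ultimately show "x \<in> (\<lambda>x. f (k, x)) ` ball 0 1" by force
    qed
  qed
  have "snd p \<in> disk_complement r (fst p) \<longleftrightarrow> \<not> (\<exists>k<r. h k p \<in> {0<..})" if "p \<in> topspace ?Z" for p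
    using that by (cases p) (simp add: disk_complement_def iff Bex_def)
  then have "topspace ?Z - {p \<in> topspace ?Z. snd p \<in> disk_complement r (fst p)} =
        (\<Union>k<r. {p \<in> topspace ?Z. h k p \<in> {0<..}})"
    by blast
  moreover have "openin ?Z \<dots>" using op by blast
  ultimately show ?thesis
    by (simp add: closedin_def)
qed

lemma continuous_map_WT_test_map:
  fixes g :: "'y \<Rightarrow> ('a::euclidean_space) config \<times> ('a \<Rightarrow> 't)"
  assumes g: "WT_test_map r T Y g"
  shows "continuous_map Y (WT_space r T) g"
proof -
  define \<B> where "\<B> = {{p \<in> WT_points r T. fst p \<in> V} | V. openin (little_disks r) V} \<union>
    {{p \<in> WT_points r T. \<forall>x \<in> K \<inter> disk_complement r (fst p). snd p x \<in> U} | K U.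
        compact K \<and> K \<subseteq> cball (0::'a) 1 \<and> openin T U}"
  let ?B = "topology_generated_by \<B>"
  have V: "openin ?B {p \<in> WT_points r T. fst p \<in> V}" if "openin (little_disks r) V" for V
    using that unfolding \<B>_def by (intro topology_generated_by_Basis) blast
  have KU: "openin ?B {p \<in> WT_points r T. \<forall>x \<in> K \<inter> disk_complement r (fst p). snd p x \<in> U}"
    if "compact K" "K \<subseteq> cball 0 1" "openin T U" for K U
    using that unfolding \<B>_def by (intro topology_generated_by_Basis) blast
  have topB: "topspace ?B = WT_points r T"
  proof
    show "topspace ?B \<subseteq> WT_points r T" unfolding \<B>_def by auto
    have "{p \<in> WT_points r T. fst p \<in> topspace (little_disks r)} = (WT_points r T :: ('a config \<times> ('a \<Rightarrow> 't)) set)"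
      by (auto simp: WT_points_def)
    then show "WT_points r T \<subseteq> topspace ?B"
      using openin_subset [OF V [OF openin_topspace]] by simp
  qed
  have "continuous_map Y ?B g"
  proof (rule continuous_on_generated_topo)
    show "g ` topspace Y \<subseteq> \<Union> \<B>"
      using g topB by (auto simp: WT_test_map_def)
    fix W assume "W \<in> \<B>"
    then consider (V) V where "openin (little_disks r) V" "W = {p \<in> WT_points r T. fst p \<in> V}"
      | (K) K U where "compact K" "K \<subseteq> cball 0 1" "openin T U"
         "W = {p \<in> WT_points r T. \<forall>x \<in> K \<inter> disk_complement r (fst p). snd p x \<in> U}"
      unfolding \<B>_def by blast
    then have "openin Y {y \<in> topspace Y. g y \<in> W}"
    proof cases
      case V
      have "{y \<in> topspace Y. g y \<in> W} = {y \<in> topspace Y. fst (g y) \<in> V}"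
        using g V(2) by (auto simp: WT_test_map_def)
      moreover have "openin Y \<dots>"
        using g V(1) by (intro openin_continuous_map_preimage) (auto simp: WT_test_map_def)
      ultimately show ?thesis by simp
    next
      case (K K U)
      let ?KY = "prod_topology (top_of_set K) Y"
      let ?LD = "prod_topology (little_disks r) (top_of_set (cball (0::'a) 1))"
      have gc: "continuous_map Y (little_disks r) (\<lambda>y. fst (g y))"
        using g by (simp add: WT_test_map_def)
      have c1: "continuous_map ?KY (little_disks r) (\<lambda>z. fst (g (snd z)))"
        using continuous_map_compose [OF continuous_map_snd gc] by (simp add: o_def)
      have c2: "continuous_map ?KY (top_of_set (cball 0 1)) fst"
      proof -
        have "continuous_map (top_of_set K) (top_of_set (cball 0 1)) (\<lambda>x. x)"
          using K(2) by (auto simp: continuous_map_in_subtopology)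
        from continuous_map_compose [OF continuous_map_fst this] show ?thesis
          by (simp add: o_def)
      qed
      have c: "continuous_map ?KY ?LD (\<lambda>z. (fst (g (snd z)), fst z))"
        using c1 c2 by (simp add: continuous_map_paired)
      define A where "A = {z \<in> topspace ?KY. fst z \<in> disk_complement r (fst (g (snd z)))}"
      have "A = {z \<in> topspace ?KY. (fst (g (snd z)), fst z) \<in>
                   {p \<in> topspace ?LD. snd p \<in> disk_complement r (fst p)}}"
        using continuous_map_image_subset_topspace [OF c] K(2) unfolding A_def by (auto simp: subset_iff)
      then have A: "closedin ?KY A"
        using closedin_continuous_map_preimage [OF c closedin_W_space] by simp
      have "continuous_map (subtopology ?KY A) (W_space r) (\<lambda>z. (fst (g (snd z)), fst z))"
        unfolding W_space_def continuous_map_in_subtopology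
        using continuous_map_from_subtopology [OF c] by (auto simp: A_def)
      moreover have "continuous_map (subtopology ?KY A) Y snd"
        by (intro continuous_map_from_subtopology continuous_map_snd)
      ultimately have "continuous_map (subtopology ?KY A) (prod_topology (W_space r) Y)
          (\<lambda>z. ((fst (g (snd z)), fst z), snd z))"
        by (simp add: continuous_map_paired)
      then have "continuous_map (subtopology ?KY A)
          (subtopology (prod_topology (W_space r) Y) {((f, x), y). f = fst (g y)})
          (\<lambda>z. ((fst (g (snd z)), fst z), snd z))"
        by (simp add: continuous_map_in_subtopology)
      then have "continuous_map (subtopology ?KY A) T
          ((\<lambda>((f, x), y). snd (g y) x) \<circ> (\<lambda>z. ((fst (g (snd z)), fst z), snd z)))"
        using g by (intro continuous_map_compose) (auto simp: WT_test_map_def)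
      then have h: "continuous_map (subtopology ?KY A) T (\<lambda>z. snd (g (snd z)) (fst z))"
        by (simp add: o_def)
      have TU: "closedin T (topspace T - U)" using K(3) by blast
      define D where "D = {z \<in> topspace (subtopology ?KY A). snd (g (snd z)) (fst z) \<in> topspace T - U}"
      have "closedin (subtopology ?KY A) D"
        unfolding D_def by (rule closedin_continuous_map_preimage [OF h TU])
      then have "closedin ?KY D" using A closedin_trans_full by blast
      moreover have "closed_map ?KY Y snd"
        using K(1) by (intro Abstract_Topological_Spaces.closed_map_snd) (simp add: compact_space_subtopology)
      ultimately have "closedin Y (snd ` D)" by (simp add: closed_map_def)
      moreover have "{y \<in> topspace Y. g y \<in> W} = topspace Y - snd ` D"
      proof -
        have "g y \<in> WT_points r T" if "y \<in> topspace Y" for y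
          using g that by (auto simp: WT_test_map_def)
        moreover have "snd (g y) x \<in> topspace T"
          if "y \<in> topspace Y" "x \<in> disk_complement r (fst (g y))" for x y
          using calculation [OF that(1)] that(2) by (auto simp: WT_points_def continuous_map_def)
        ultimately show ?thesis
          unfolding K(4) D_def A_def by (force simp: image_iff)
      qed
      ultimately show ?thesis by auto
    qed
    moreover have "g -` W \<inter> topspace Y = {y \<in> topspace Y. g y \<in> W}" by blast
    ultimately show "openin Y (g -` W \<inter> topspace Y)" by simp
  qed
  moreover have "WT_test_map r T ?B (\<lambda>p. p)"
    unfolding WT_test_map_def
  proof (intro conjI)
    show "(\<lambda>p. p) \<in> topspace ?B \<rightarrow> WT_points r T" unfolding topB by simp
    show "continuous_map ?B (little_disks r) fst"
      unfolding continuous_map topB using V by (auto simp: WT_points_def)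
    let ?F = "subtopology (prod_topology (W_space r) ?B)
                {((f :: 'a config, x :: 'a), p :: 'a config \<times> ('a \<Rightarrow> 't)). f = fst p}"
    have topF: "z \<in> topspace ?F \<longleftrightarrow>
        (\<exists>f \<xi> x. z = ((f, x), (f, \<xi>)) \<and> (f, \<xi>) \<in> WT_points r T \<and> x \<in> disk_complement r f)" for z
      unfolding topspace_subtopology topspace_prod_topology topB W_space_def
      by (cases z) (auto simp: WT_points_def disk_complement_def)
    show "continuous_map ?F T (\<lambda>((f, x), p). snd p x)"
      unfolding continuous_map_def
    proof (intro conjI allI impI)
      show "(\<lambda>((f, x), p). snd p x) \<in> topspace ?F \<rightarrow> topspace T"
        by (auto simp: topF WT_points_def continuous_map_def simp del: topspace_subtopology)
      fix U assume U: "openin T U"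
      show "openin ?F {z \<in> topspace ?F. (\<lambda>((f, x), p). snd p x) z \<in> U}"
      proof (subst openin_subopen, intro ballI)
        fix z assume z: "z \<in> {z \<in> topspace ?F. (\<lambda>((f, x), p). snd p x) z \<in> U}"
        then have "z \<in> topspace ?F" by blast
        then obtain f \<xi> x where zeq: "z = ((f, x), (f, \<xi>))" and fxi: "(f, \<xi>) \<in> WT_points r T"
          and x: "x \<in> disk_complement r f"
          unfolding topF by blast
        have xU: "\<xi> x \<in> U" using z by (simp add: zeq)
        have "continuous_map (top_of_set (disk_complement r f)) T \<xi>"
          using fxi by (simp add: WT_points_def)
        then have "openin (top_of_set (disk_complement r f)) {x \<in> disk_complement r f. \<xi> x \<in> U}"
          using openin_continuous_map_preimage [OF _ U] by force
        then obtain \<epsilon> where \<epsilon>: "\<epsilon> > 0"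
          "\<And>y. y \<in> disk_complement r f \<Longrightarrow> dist y x < \<epsilon> \<Longrightarrow> \<xi> y \<in> U"
          using x xU unfolding openin_euclidean_subtopology_iff by blast
        define K where "K = cball x (\<epsilon>/2) \<inter> cball 0 1"
        have K: "compact K" "K \<subseteq> cball 0 1" by (auto simp: K_def compact_Int)
        define N where "N = {p \<in> WT_points r T. \<forall>x \<in> K \<inter> disk_complement r (fst p). snd p x \<in> U}"
        have N: "openin ?B N" unfolding N_def by (rule KU [OF K U])
        have fN: "(f, \<xi>) \<in> N"
          using fxi \<epsilon> by (auto simp: N_def K_def dist_commute)
        have "continuous_map (W_space r) (euclidean :: 'a topology) snd"
          unfolding W_space_def
          using continuous_map_snd [of "little_disks r" "top_of_set (cball (0::'a) 1)"]
          using continuous_map_into_fulltopology continuous_map_from_subtopology by blast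
        then have M: "openin (W_space r) {w \<in> topspace (W_space r). snd w \<in> ball x (\<epsilon>/2)}"
          by (rule openin_continuous_map_preimage) auto
        define Q where "Q = topspace ?F \<inter> ({w \<in> topspace (W_space r). snd w \<in> ball x (\<epsilon>/2)} \<times> N)"
        have "openin ?F Q"
        proof -
          have op: "openin (prod_topology (W_space r) ?B)
              ({w \<in> topspace (W_space r). snd w \<in> ball x (\<epsilon>/2)} \<times> N)" (is "openin ?WB ?O")
            using M N by (simp only: openin_prod_Times_iff) blast
          have "Q = ?O \<inter> {((f, x), p). f = fst p}"
            using openin_subset [OF op] unfolding Q_def topspace_subtopology by blast
          then show ?thesis
            unfolding openin_subtopology using op by blast
        qed
        moreover have "z \<in> Q"
        proof -
          have "z \<in> topspace ?F" using z by blast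
          moreover from this have "(f, x) \<in> topspace (W_space r)" by (simp add: zeq)
          ultimately show ?thesis using \<epsilon>(1) fN unfolding Q_def zeq by simp
        qed
        moreover have "Q \<subseteq> {z \<in> topspace ?F. (\<lambda>((f, x), p). snd p x) z \<in> U}"
        proof
          fix w assume w: "w \<in> Q"
          then have "w \<in> topspace ?F" unfolding Q_def by blast
          then obtain f' \<xi>' x' where weq: "w = ((f', x'), (f', \<xi>'))" "x' \<in> disk_complement r f'"
            using topF by blast
          have "x' \<in> K" "(f', \<xi>') \<in> N"
            using w weq unfolding Q_def K_def by (auto simp: disk_complement_def)
          then have "\<xi>' x' \<in> U" using weq(2) by (auto simp: N_def)
          then show "w \<in> {z \<in> topspace ?F. (\<lambda>((f, x), p). snd p x) z \<in> U}"
            using \<open>w \<in> topspace ?F\<close> weq(1) by simp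
        qed
        ultimately show "\<exists>Q. openin ?F Q \<and> z \<in> Q \<and>
            Q \<subseteq> {z \<in> topspace ?F. (\<lambda>((f, x), p). snd p x) z \<in> U}"
          by blast
      qed
    qed
  qed
  then have "openin ?B {p \<in> topspace ?B. p \<in> U}" if "openin (WT_space r T) U" for U
    using that unfolding openin_WT_space by blast
  then have "continuous_map ?B (WT_space r T) (\<lambda>p. p)"
    unfolding continuous_map_def topspace_WT_space topB by auto
  ultimately have "continuous_map Y (WT_space r T) ((\<lambda>p. p) \<circ> g)"
    by (rule continuous_map_compose)
  then show ?thesis by (simp add: o_def)
qed

section \<open>The operad \<open>E\<^sub>n\<^sup>T\<close>\<close>

definition sphere_maps :: "'t topology \<Rightarrow> ('a::euclidean_space \<Rightarrow> 't) set" where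
  "sphere_maps T = {\<phi> \<in> extensional (sphere 0 1). continuous_map (top_of_set (sphere 0 1)) T \<phi>}"

definition ET_space ::
  "'t topology \<Rightarrow> ('a::euclidean_space \<Rightarrow> 't) \<Rightarrow> ('a \<Rightarrow> 't) list \<Rightarrow>
     ('a config \<times> ('a \<Rightarrow> 't)) topology" where
  "ET_space T \<psi> \<phi>s =
     subtopology (WT_space (length \<phi>s) T)
       {(f, \<xi>). (\<forall>k<length \<phi>s. \<forall>z\<in>sphere 0 1. \<xi> (f (k, z)) = (\<phi>s ! k) z) \<and>
                (\<forall>z\<in>sphere 0 1. \<xi> z = \<psi> z)}"

definition ET_id :: "('a::euclidean_space \<Rightarrow> 't) \<Rightarrow> 'a config \<times> ('a \<Rightarrow> 't)" where
  "ET_id \<phi> = (little_disks_id, \<phi>)"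

definition ET_act ::
  "('a::euclidean_space \<Rightarrow> 't) \<Rightarrow> ('a \<Rightarrow> 't) list \<Rightarrow> (nat \<Rightarrow> nat) \<Rightarrow>
     'a config \<times> ('a \<Rightarrow> 't) \<Rightarrow> 'a config \<times> ('a \<Rightarrow> 't)" where
  "ET_act \<psi> \<phi>s \<sigma> = (\<lambda>(f, \<xi>). (little_disks_act (length \<phi>s) \<sigma> f, \<xi>))"

text \<open>
  The map \<open>\<xi> \<union> \<mu>\<^sub>0 \<union> \<dots>\<close> on the complement of \<open>f \<circ> (g\<^sub>0, \<dots>)\<close>, as the union of the graphs of \<open>\<xi>\<close>
  and of the \<open>\<mu> j\<close> transported by the \<open>j\<close>-th embedding of \<open>f\<close>.
\<close>

definition glue_maps ::
  "nat list \<Rightarrow> ('a::euclidean_space) config \<times> ('a \<Rightarrow> 't) \<Rightarrow>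
     (nat \<Rightarrow> 'a config \<times> ('a \<Rightarrow> 't)) \<Rightarrow> 'a \<Rightarrow> 't" where
  "glue_maps ns = (\<lambda>(f, \<xi>) q.
     \<lambda>x\<in>disk_complement (sum_list ns) (little_disks_comp ns f (\<lambda>j. fst (q j))).
       THE t. (x \<in> disk_complement (length ns) f \<and> t = \<xi> x) \<or>
              (\<exists>j<length ns. \<exists>z\<in>disk_complement (ns ! j) (fst (q j)).
                 x = f (j, z) \<and> t = snd (q j) z))"

definition ET_comp ::
  "('a::euclidean_space \<Rightarrow> 't) \<Rightarrow> ('a \<Rightarrow> 't) list \<Rightarrow> ('a \<Rightarrow> 't) list list \<Rightarrow>
     'a config \<times> ('a \<Rightarrow> 't) \<Rightarrow> (nat \<Rightarrow> 'a config \<times> ('a \<Rightarrow> 't)) \<Rightarrow> 'a config \<times> ('a \<Rightarrow> 't)" where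
  "ET_comp \<psi> \<phi>s \<theta>ss p q =
     (little_disks_comp (map length \<theta>ss) (fst p) (\<lambda>j. fst (q j)),
      glue_maps (map length \<theta>ss) p q)"

end

theory Submission
  imports Defs
begin

text \<open>
  A little disk is determined by its centre and radius, so \<open>E\<^sub>n(r)\<close> carries the topology of
  pointwise convergence.  The identity of \<open>W\<^sub>n\<^sup>T(r)\<close> is itself a test map, because the projection
  \<open>Y \<times> K \<rightarrow> Y\<close> along a compact \<open>K\<close> is closed; hence a map into \<open>W\<^sub>n\<^sup>T(r)\<close> is continuous if and
  only if it is a test map.  Continuity of the composition is thereby reduced to the joint continuity
  of \<open>(y, x) \<mapsto> (\<xi> \<union> \<mu>\<^sub>0 \<union> \<dots>) x\<close>, which holds since this map is continuous on each of the finitely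
  many closed sets given by the complement of \<open>f\<close> and by the images of the disks of \<open>f\<close>.  The operad
  axioms then only compare maps glued from the same pieces.
\<close>

section \<open>Block numbering\<close>

text \<open>The obstacle is that a final topology controls maps out of a space, while composition is
  a map out of a product of such spaces, and a product of final topologies need not be final.
  Feeding test maps into the factors would therefore say nothing about the product topology.
  Compactness of the unit ball removes the obstacle: evaluation (p, x) \<mapsto> \<xi> x becomes
  jointly continuous, as for the compact-open topology over a compact Hausdorff source. The domain
  of \<xi> varies with the configuration here, which does no harm because the domains form a closed
  subset of the product with the ball. A second difficulty is that closed disks may be tangent to
  each other, so the pieces of a glued map overlap in more than the expected spheres. A point common
  to two different disks lies on both boundary spheres, hence in the complement of \<open>f\<close>,
  where \<xi> supplies the common value.\<close>

lemma nth_concat_block_offset: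
  assumes "j < length xss" "i < length (xss ! j)"
  shows "concat xss ! (block_offset (map length xss) j + i) = xss ! j ! i"
  using assms
proof (induction xss arbitrary: j)
  case (Cons xs xss)
  then show ?case
    by (cases j) (auto simp: block_offset_def nth_append add.assoc)
qed simp

lemma block_offset_less:
  assumes "j < length ns" "i < ns ! j"
  shows "block_offset ns j + i < sum_list ns"
proof -
  have "sum_list (take (Suc j) ns) + sum_list (drop (Suc j) ns) = sum_list ns"
    by (metis append_take_drop_id sum_list_append)
  then show ?thesis
    using assms by (simp add: block_offset_def take_Suc_conv_app_nth)
qed

lemma block_offset_cases:
  assumes "k < sum_list ns"
  obtains j i where "j < length ns" "i < ns ! j" "k = block_offset ns j + i"
  using assms
proof (induction ns arbitrary: k thesis)
  case (Cons n ns)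
  show ?case
  proof (cases "k < n")
    case True
    then show ?thesis
      using Cons.prems(1) [of 0 k] by (simp add: block_offset_def)
  next
    case False
    then have "k - n < sum_list ns"
      using Cons.prems(2) by simp
    then obtain j i where "j < length ns" "i < ns ! j" "k - n = block_offset ns j + i"
      using Cons.IH by blast
    then show ?thesis
      using Cons.prems(1) [of "Suc j" i] False by (simp add: block_offset_def)
  qed
qed simp

lemma nth_block_index:
  assumes "j < length ns" "i < ns ! j"
  shows "block_index ns ! (block_offset ns j + i) = (j, i)"
proof -
  let ?xss = "map (\<lambda>j. map (Pair j) [0..<ns ! j]) [0..<length ns]"
  have "map length ?xss = ns"
    by (rule nth_equalityI) auto
  then show ?thesis
    using nth_concat_block_offset [of j ?xss i] assms by (simp add: block_index_def)
qed

text \<open>Serves associativity: the position of an input of a threefold composite is the same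
  whether the two outer levels or the two inner levels are flattened before the remaining
  one.\<close>

lemma block_offset_concat:
  assumes "j < length xsss" "l < length (xsss ! j)"
  shows "block_offset (map length (concat xsss)) (block_offset (map length xsss) j + l) =
         block_offset (map (\<lambda>xss. length (concat xss)) xsss) j + block_offset (map length (xsss ! j)) l"
  using assms
proof (induction xsss arbitrary: j)
  case (Cons xss xsss)
  then show ?case
  proof (cases j)
    case 0
    then show ?thesis
      using Cons.prems by (simp add: block_offset_def)
  next
    case (Suc i)
    then show ?thesis
      using Cons.IH [of i] Cons.prems
      by (simp add: block_offset_def add.assoc take_map length_concat)
  qed
qed simp

lemma sum_list_permute_list:
  assumes "\<sigma> permutes {..<length ns}"
  shows "sum_list (permute_list \<sigma> ns) = sum_list (ns :: nat list)"
  using mset_permute_list [OF assms] by (metis sum_mset_sum_list)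

text \<open>Block \<open>j\<close> of the permuted list is block \<open>\<sigma> j\<close> of
  \<open>ns\<close>, hence the bound \<open>ns ! \<sigma> j\<close> on \<open>i\<close>. Since every
  position is an offset plus an index, this formula determines the permutation.\<close>

lemma block_perm_offset:
  assumes \<sigma>: "\<sigma> permutes {..<length ns}" and "j < length ns" "i < ns ! \<sigma> j"
  shows "block_perm \<sigma> ns (block_offset (permute_list \<sigma> ns) j + i) = block_offset ns (\<sigma> j) + i"
proof -
  have "i < permute_list \<sigma> ns ! j"
    using assms by (simp add: permute_list_nth)
  then show ?thesis
    using assms block_offset_less [of j "permute_list \<sigma> ns" i]
    by (simp add: block_perm_def nth_block_index sum_list_permute_list)
qed

lemma block_sum_perm_offset:
  assumes "j < length ns" "i < ns ! j"
  shows "block_sum_perm \<tau> ns (block_offset ns j + i) = block_offset ns j + \<tau> j i"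
  using assms by (simp add: block_sum_perm_def nth_block_index block_offset_less)


section \<open>Geometry of little disks\<close>

definition disk_centre :: "('a::euclidean_space) config \<Rightarrow> nat \<Rightarrow> 'a" where
  "disk_centre f k = f (k, 0)"

text \<open>For an affine disk this is the scaling factor. It is written with evaluations at two
  fixed points, instead of choosing the factor \<open>a\<close>, so that its continuity in
  \<open>f\<close> follows from that of evaluations.\<close>

definition disk_radius :: "('a::euclidean_space) config \<Rightarrow> nat \<Rightarrow> real" where
  "disk_radius f k = norm (f (k, SOME b. b \<in> Basis) - f (k, 0))"

lemma norm_SOME_Basis: "norm (SOME b. b \<in> Basis :: 'a::euclidean_space) = 1"
  by (rule norm_Basis) (simp add: some_in_eq)

lemma disk_radius_eq:
  assumes "a > 0" "\<And>x. x \<in> cball 0 1 \<Longrightarrow> f (k, x) = a *\<^sub>R x + c"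
  shows "disk_radius f k = a"
  using assms by (simp add: disk_radius_def norm_SOME_Basis)

lemma affine_image_ball:
  fixes f :: "('a::euclidean_space) config"
  assumes a: "a > 0" and eq: "\<And>x. x \<in> cball 0 1 \<Longrightarrow> f (k, x) = a *\<^sub>R x + c"
  shows "(\<lambda>x. f (k, x)) ` ball 0 1 = ball c a"
    and "(\<lambda>x. f (k, x)) ` cball 0 1 = cball c a"
proof -
  have *: "x \<in> (\<lambda>x. f (k, x)) ` S \<longleftrightarrow> (x - c) /\<^sub>R a \<in> S" if "S \<subseteq> cball 0 1" for S x
  proof
    assume "x \<in> (\<lambda>x. f (k, x)) ` S"
    then show "(x - c) /\<^sub>R a \<in> S"
      using that a eq by auto
  next
    assume S: "(x - c) /\<^sub>R a \<in> S"
    then have "x = f (k, (x - c) /\<^sub>R a)"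
      using that a eq [of "(x - c) /\<^sub>R a"] by auto
    with S show "x \<in> (\<lambda>x. f (k, x)) ` S" by blast
  qed
  have n: "norm ((x - c) /\<^sub>R a) = dist c x / a" for x
    using a by (simp only: norm_scaleR) (simp add: dist_norm norm_minus_commute divide_inverse_commute)
  show "(\<lambda>x. f (k, x)) ` ball 0 1 = ball c a" "(\<lambda>x. f (k, x)) ` cball 0 1 = cball c a"
    unfolding set_eq_iff *[OF ball_subset_cball] *[OF order_refl]
    using a by (simp_all only: mem_ball_0 mem_cball_0 n) simp_all
qed

lemma mem_disk_complement_iff:
  "x \<in> disk_complement r f \<longleftrightarrow> x \<in> cball 0 1 \<and> (\<forall>k<r. \<forall>z\<in>ball 0 1. x \<noteq> f (k, z))"
  unfolding disk_complement_def by blast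

context
  fixes r :: nat and f :: "('a::euclidean_space) config"
  assumes f: "f \<in> topspace (little_disks r)"
begin

lemma
  assumes "k < r"
  shows disk_radius_pos: "disk_radius f k > 0"
    and little_disk_eq: "x \<in> cball 0 1 \<Longrightarrow> f (k, x) = disk_radius f k *\<^sub>R x + disk_centre f k"
proof -
  obtain a c where a: "a > 0" and eq: "\<And>x. x \<in> cball 0 1 \<Longrightarrow> f (k, x) = a *\<^sub>R x + c"
    using little_disksD [OF f \<open>k < r\<close>] by blast
  have "disk_radius f k = a"
    using a eq by (rule disk_radius_eq)
  then show "disk_radius f k > 0"
    and "x \<in> cball 0 1 \<Longrightarrow> f (k, x) = disk_radius f k *\<^sub>R x + disk_centre f k"
    using a eq [of x] eq [of 0] by (simp_all add: disk_centre_def)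
qed

lemma little_disk_eq_iff:
  assumes "k < r" "z \<in> cball 0 1"
  shows "x = f (k, z) \<longleftrightarrow> z = (x - disk_centre f k) /\<^sub>R disk_radius f k"
  using assms disk_radius_pos [OF \<open>k < r\<close>] by (auto simp: little_disk_eq)

lemma dist_disk_centre:
  assumes "k < r" "z \<in> cball 0 1"
  shows "dist (disk_centre f k) (f (k, z)) = disk_radius f k * norm z"
  using assms disk_radius_pos [OF \<open>k < r\<close>] by (simp add: little_disk_eq dist_norm)

lemma little_disk_image:
  assumes "k < r"
  shows "(\<lambda>x. f (k, x)) ` ball 0 1 = ball (disk_centre f k) (disk_radius f k)"
    and "(\<lambda>x. f (k, x)) ` cball 0 1 = cball (disk_centre f k) (disk_radius f k)"
  using affine_image_ball [of "disk_radius f k" f k] disk_radius_pos little_disk_eq assms by blast+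

end

text \<open>A map that is affine on each summand is continuous, and the interior of the image of the
  closed ball is the image of the open ball. Continuity and interiors thus give way to pointwise
  conditions, which can be checked disk by disk for relabelled and composed configurations.\<close>

lemma topspace_little_disks_iff:
  fixes f :: "('a::euclidean_space) config"
  shows "f \<in> topspace (little_disks r) \<longleftrightarrow>
    f \<in> extensional ({..<r} \<times> cball 0 1) \<and>
    (\<forall>k<r. \<exists>a>0. \<exists>c. \<forall>x\<in>cball 0 1. f (k, x) = a *\<^sub>R x + c) \<and>
    (\<forall>k<r. \<forall>x\<in>cball 0 1. f (k, x) \<in> cball 0 1) \<and>
    (\<forall>k<r. \<forall>l<r. \<forall>x\<in>ball 0 1. \<forall>y\<in>ball 0 1. f (k, x) = f (l, y) \<longrightarrow> k = l)"
    (is "?L \<longleftrightarrow> ?E \<and> ?A \<and> ?D \<and> ?I")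
proof -
  let ?X = "sum_topology (\<lambda>k. top_of_set (cball (0::'a) 1)) {..<r}"
  have top: "topspace ?X = {..<r} \<times> cball 0 1"
    by auto
  have "continuous_map ?X (top_of_set (cball 0 1)) f \<longleftrightarrow> ?D" if ?A
  proof
    assume D: ?D
    have "openin ?X {p \<in> {..<r} \<times> cball 0 1. f p \<in> U}" if U: "openin (top_of_set (cball 0 1)) U" for U
      unfolding openin_sum_topology
    proof (intro conjI ballI)
      fix k assume "k \<in> {..<r}"
      then obtain a c where ac: "\<And>x. x \<in> cball 0 1 \<Longrightarrow> f (k, x) = a *\<^sub>R x + c"
        using \<open>?A\<close> by blast
      have "continuous_on (cball 0 1) (\<lambda>x. a *\<^sub>R x + c)"
        by (intro continuous_intros)
      then have "continuous_on (cball 0 1) (\<lambda>x. f (k, x))"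
        by (rule continuous_on_eq) (simp add: ac)
      moreover have "(\<lambda>x. f (k, x)) \<in> cball 0 1 \<rightarrow> cball 0 1"
        using D \<open>k \<in> {..<r}\<close> by blast
      ultimately have "openin (top_of_set (cball 0 1)) (cball 0 1 \<inter> (\<lambda>x. f (k, x)) -` U)"
        using U continuous_openin_preimage by blast
      moreover have "{x. (k, x) \<in> {p \<in> {..<r} \<times> cball 0 1. f p \<in> U}} = cball 0 1 \<inter> (\<lambda>x. f (k, x)) -` U"
        using \<open>k \<in> {..<r}\<close> by auto
      ultimately show "openin (top_of_set (cball 0 1)) {x. (k, x) \<in> {p \<in> {..<r} \<times> cball 0 1. f p \<in> U}}"
        by simp
    qed auto
    then show "continuous_map ?X (top_of_set (cball 0 1)) f"
      unfolding continuous_map_def top using D by auto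
  qed (auto simp: continuous_map_def Pi_iff)
  moreover have "pairwise (\<lambda>k l. disjnt (interior ((\<lambda>x. f (k, x)) ` cball 0 1))
                                  (interior ((\<lambda>x. f (l, x)) ` cball 0 1))) {..<r} \<longleftrightarrow> ?I" if ?A
  proof -
    have "interior ((\<lambda>x. f (k, x)) ` cball 0 1) = (\<lambda>x. f (k, x)) ` ball 0 1" if "k < r" for k
      using \<open>?A\<close> that affine_image_ball by (metis interior_cball)
    then have "pairwise (\<lambda>k l. disjnt (interior ((\<lambda>x. f (k, x)) ` cball 0 1))
                              (interior ((\<lambda>x. f (l, x)) ` cball 0 1))) {..<r} \<longleftrightarrow>
          (\<forall>k<r. \<forall>l<r. k \<noteq> l \<longrightarrow> disjnt ((\<lambda>x. f (k, x)) ` ball 0 1) ((\<lambda>x. f (l, x)) ` ball 0 1))"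
      by (simp add: pairwise_def Ball_def)
    also have "\<dots> \<longleftrightarrow> ?I"
      unfolding disjnt_iff image_iff by metis
    finally show ?thesis .
  qed
  ultimately show ?thesis
    unfolding little_disks_def topspace_subtopology topspace_compact_open top by blast
qed

context
  fixes r :: nat and f :: "('a::euclidean_space) config"
  assumes f: "f \<in> topspace (little_disks r)"
begin

lemma little_disk_in_cball:
  assumes "k < r" "x \<in> cball 0 1"
  shows "f (k, x) \<in> cball 0 1"
  using f assms unfolding topspace_little_disks_iff by blast

text \<open>Interiors are monotone, so a closed disk inside the closed unit ball has its interior
  inside the open one. This keeps the outer sphere in every complement and the open disks of a
  composite inside the open disks of \<open>f\<close>.\<close>

lemma little_disk_in_ball:
  assumes "k < r" "x \<in> ball 0 1"
  shows "f (k, x) \<in> ball 0 1"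
proof -
  have "cball (disk_centre f k) (disk_radius f k) \<subseteq> cball 0 1"
    unfolding little_disk_image(2) [OF f \<open>k < r\<close>, symmetric]
    using little_disk_in_cball [OF \<open>k < r\<close>] by (rule image_subsetI)
  then have "ball (disk_centre f k) (disk_radius f k) \<subseteq> ball 0 1"
    unfolding interior_cball [symmetric] by (rule interior_mono)
  then show ?thesis
    using assms little_disk_image(1) [OF f \<open>k < r\<close>] by blast
qed

lemma little_disk_inj:
  assumes "k < r" "x \<in> cball 0 1" "y \<in> cball 0 1" "f (k, x) = f (k, y)"
  shows "x = y"
  using assms little_disk_eq_iff [OF f] by metis

text \<open>
  An open ball that meets a closed ball also meets its interior.
\<close>

lemma little_disk_disjoint:
  assumes "k < r" "l < r" "x \<in> cball 0 1" "y \<in> ball 0 1" "f (k, x) = f (l, y)"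
  shows "k = l"
proof (rule ccontr)
  assume "k \<noteq> l"
  let ?B = "\<lambda>k. ball (disk_centre f k) (disk_radius f k)"
  have "\<not> (\<exists>x\<in>ball 0 1. \<exists>y\<in>ball 0 1. f (k, x) = f (l, y))"
    using f assms(1,2) \<open>k \<noteq> l\<close> unfolding topspace_little_disks_iff by blast
  then have "?B k \<inter> ?B l = {}"
    unfolding little_disk_image [OF f, symmetric, OF assms(1)] little_disk_image [OF f, symmetric, OF assms(2)]
    by blast
  then have "?B l \<inter> closure (?B k) = {}"
    by (metis Int_commute open_Int_closure_eq_empty open_ball)
  moreover have "f (k, x) \<in> closure (?B k)"
    using little_disk_image(2) [OF f assms(1)] disk_radius_pos [OF f assms(1)] assms(3) by auto
  moreover have "f (k, x) \<in> ?B l"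
    using little_disk_image(1) [OF f assms(2)] assms(4,5) by auto
  ultimately show False by blast
qed

text \<open>A boundary point of one disk lies in no other open disk, even where two disks touch. So
  \<xi> is defined along all inner spheres, and an inserted piece meets the complement of
  \<open>f\<close> only along such a sphere.\<close>

lemma little_disk_in_complement_iff:
  assumes "k < r" "z \<in> cball 0 1"
  shows "f (k, z) \<in> disk_complement r f \<longleftrightarrow> z \<in> sphere 0 1"
proof
  assume "f (k, z) \<in> disk_complement r f"
  then have "z \<notin> ball 0 1"
    using assms(1) unfolding mem_disk_complement_iff by blast
  then show "z \<in> sphere 0 1"
    using assms(2) by auto
next
  assume "z \<in> sphere 0 1"
  then have "z \<notin> ball 0 1" by auto
  then have "\<not> (\<exists>l<r. \<exists>y\<in>ball 0 1. f (k, z) = f (l, y))"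
    using little_disk_disjoint [OF assms(1) _ assms(2)] little_disk_inj [OF assms]
    by (metis ball_subset_cball subsetD)
  then show "f (k, z) \<in> disk_complement r f"
    using little_disk_in_cball [OF assms] unfolding mem_disk_complement_iff by blast
qed

lemma sphere_subset_disk_complement: "sphere 0 1 \<subseteq> disk_complement r f"
proof
  fix x :: 'a assume x: "x \<in> sphere 0 1"
  then have "x \<noteq> f (k, y)" if "k < r" "y \<in> ball 0 1" for k y
    using little_disk_in_ball [OF that] by auto
  with x sphere_cball show "x \<in> disk_complement r f"
    unfolding mem_disk_complement_iff by blast
qed

end

lemma disk_complement_subset: "disk_complement r f \<subseteq> cball 0 1"
  by (auto simp: disk_complement_def)

section \<open>Composite configurations and their complements\<close>

lemma little_disks_comp_apply:
  assumes "j < length ns" "i < ns ! j" "x \<in> cball 0 1"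
  shows "little_disks_comp ns f g (block_offset ns j + i, x) = f (j, g j (i, x))"
  using assms by (simp add: little_disks_comp_def nth_block_index block_offset_less)

lemma little_disks_comp_in:
  fixes f :: "('a::euclidean_space) config"
  assumes f: "f \<in> topspace (little_disks (length ns))"
    and g: "\<And>j. j < length ns \<Longrightarrow> g j \<in> topspace (little_disks (ns ! j))"
  shows "little_disks_comp ns f g \<in> topspace (little_disks (sum_list ns))"
  unfolding topspace_little_disks_iff
proof (intro conjI allI impI ballI)
  show "little_disks_comp ns f g \<in> extensional ({..<sum_list ns} \<times> cball 0 1)"
    by (simp add: little_disks_comp_def)
next
  fix k assume "k < sum_list ns"
  then obtain j i where ji: "j < length ns" "i < ns ! j" "k = block_offset ns j + i"
    by (rule block_offset_cases)
  note gj = g [OF ji(1)]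
  let ?a = "disk_radius f j" and ?b = "disk_radius (g j) i"
  have "little_disks_comp ns f g (k, x) =
      (?a * ?b) *\<^sub>R x + (?a *\<^sub>R disk_centre (g j) i + disk_centre f j)" if "x \<in> cball 0 1" for x
  proof -
    have "little_disks_comp ns f g (k, x) = f (j, g j (i, x))"
      using ji that by (simp add: little_disks_comp_apply)
    then show ?thesis
      using little_disk_eq [OF f ji(1) little_disk_in_cball [OF gj ji(2) that]]
        little_disk_eq [OF gj ji(2) that] by (simp add: algebra_simps)
  qed
  moreover have "?a * ?b > 0"
    using disk_radius_pos [OF f ji(1)] disk_radius_pos [OF gj ji(2)] by simp
  ultimately show "\<exists>a>0. \<exists>c. \<forall>x\<in>cball 0 1. little_disks_comp ns f g (k, x) = a *\<^sub>R x + c"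
    by blast
  show "little_disks_comp ns f g (k, x) \<in> cball 0 1" if "x \<in> cball 0 1" for x
    using that ji little_disk_in_cball [OF f ji(1)] little_disk_in_cball [OF gj ji(2)]
    by (simp add: little_disks_comp_apply)
next
  fix k l x y assume "k < sum_list ns" "l < sum_list ns" and x: "x \<in> ball 0 1" and y: "y \<in> ball 0 1"
    and eq: "little_disks_comp ns f g (k, x) = little_disks_comp ns f g (l, y)"
  obtain j i where ji: "j < length ns" "i < ns ! j" "k = block_offset ns j + i"
    using block_offset_cases [OF \<open>k < sum_list ns\<close>] by metis
  obtain j' i' where ji': "j' < length ns" "i' < ns ! j'" "l = block_offset ns j' + i'"
    using block_offset_cases [OF \<open>l < sum_list ns\<close>] by metis
  have u: "g j (i, x) \<in> ball 0 1" and v: "g j' (i', y) \<in> ball 0 1"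
    using little_disk_in_ball [OF g] ji ji' x y by auto
  have "f (j, g j (i, x)) = f (j', g j' (i', y))"
    using eq x y ji ji' by (simp add: little_disks_comp_apply)
  \<comment> \<open>Both inner points are interior points of the unit ball, so disjointness of the
    disks of \<open>f\<close> identifies the blocks before the disks inside a block are
    compared.\<close>
  then have "j = j'" "g j (i, x) = g j' (i', y)"
    using little_disk_disjoint [OF f ji(1) ji'(1) _ v] little_disk_inj [OF f ji(1)] u v
    by (metis ball_subset_cball subsetD)+
  then have "i = i'"
    using little_disk_disjoint [OF g [OF ji(1)] ji(2)] x y ji'(2) by (metis ball_subset_cball subsetD)
  with \<open>j = j'\<close> show "k = l"
    by (simp add: ji(3) ji'(3))
qed

text \<open>This is the decomposition along which maps are glued. A point outside the complement of
  \<open>f\<close> is \<open>f (j, z)\<close> for an interior \<open>z\<close>, and it survives in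
  the composite exactly if \<open>z\<close> survives in \<open>g j\<close>. Conversely, the open
  disks of the composite lie inside those of \<open>f\<close>, so the complement of \<open>f\<close>
  is kept as a whole.\<close>

lemma disk_complement_little_disks_comp:
  fixes f :: "('a::euclidean_space) config"
  assumes f: "f \<in> topspace (little_disks (length ns))"
    and g: "\<And>j. j < length ns \<Longrightarrow> g j \<in> topspace (little_disks (ns ! j))"
  shows "disk_complement (sum_list ns) (little_disks_comp ns f g) =
    disk_complement (length ns) f \<union> (\<Union>j<length ns. (\<lambda>z. f (j, z)) ` disk_complement (ns ! j) (g j))"
    (is "?L = ?A \<union> ?B")
proof -
  have L: "x \<in> ?L \<longleftrightarrow> x \<in> cball 0 1 \<and> (\<forall>j<length ns. \<forall>i<ns ! j. \<forall>z\<in>ball 0 1. x \<noteq> f (j, g j (i, z)))" for x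
  proof -
    have "(\<forall>k<sum_list ns. \<forall>z\<in>ball 0 1. x \<noteq> little_disks_comp ns f g (k, z)) \<longleftrightarrow>
        (\<forall>j<length ns. \<forall>i<ns ! j. \<forall>z\<in>ball 0 1. x \<noteq> f (j, g j (i, z)))" (is "?l \<longleftrightarrow> ?r")
    proof
      assume l: ?l
      show ?r
      proof (intro allI impI ballI)
        fix j i z assume "j < length ns" "i < ns ! j" and z: "z \<in> ball (0::'a) 1"
        with l block_offset_less z have "x \<noteq> little_disks_comp ns f g (block_offset ns j + i, z)"
          by blast
        then show "x \<noteq> f (j, g j (i, z))"
          using \<open>j < length ns\<close> \<open>i < ns ! j\<close> z by (simp add: little_disks_comp_apply)
      qed
    next
      assume ?r
      show ?l
      proof (intro allI impI ballI)
        fix k z assume "k < sum_list ns" and z: "z \<in> ball (0::'a) 1"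
        then obtain j i where "j < length ns" "i < ns ! j" "k = block_offset ns j + i"
          by (auto elim: block_offset_cases)
        with z \<open>?r\<close> show "x \<noteq> little_disks_comp ns f g (k, z)"
          by (simp add: little_disks_comp_apply)
      qed
    qed
    then show ?thesis
      unfolding mem_disk_complement_iff by blast
  qed
  show ?thesis
  proof (intro equalityI subsetI)
    fix x assume x: "x \<in> ?L"
    show "x \<in> ?A \<union> ?B"
    proof (cases "x \<in> ?A")
      case False
      then obtain j z where jz: "j < length ns" "z \<in> ball 0 1" "x = f (j, z)"
        using x L unfolding mem_disk_complement_iff by blast
      have "z \<noteq> g j (i, w)" if "i < ns ! j" "w \<in> ball 0 1" for i w
        using x jz(1,3) that unfolding L by blast
      then have "z \<in> disk_complement (ns ! j) (g j)"
        using jz(2) ball_subset_cball unfolding mem_disk_complement_iff by blast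
      with jz show ?thesis by blast
    qed simp
  next
    fix x assume "x \<in> ?A \<union> ?B"
    then consider "x \<in> ?A" | j z where "j < length ns" "z \<in> disk_complement (ns ! j) (g j)" "x = f (j, z)"
      by blast
    then show "x \<in> ?L"
    proof cases
      case 1
      then have "x \<noteq> f (j, g j (i, z))" if "j < length ns" "i < ns ! j" "z \<in> ball 0 1" for j i z
        using little_disk_in_ball [OF g [OF that(1)] that(2,3)] that(1)
        unfolding mem_disk_complement_iff by blast
      with 1 show ?thesis
        unfolding L using disk_complement_subset by blast
    next
      case (2 j z)
      then have z: "z \<in> cball 0 1" using disk_complement_subset by blast
      have "x \<noteq> f (j', g j' (i, w))" if "j' < length ns" "i < ns ! j'" "w \<in> ball 0 1" for j' i w
      proof
        assume eq: "x = f (j', g j' (i, w))"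
        have b: "g j' (i, w) \<in> ball 0 1"
          using little_disk_in_ball [OF g] that by blast
        \<comment> \<open>Here \<open>z\<close> may lie on the boundary sphere, where the
          \<open>j\<close>-th disk can touch another one. The other preimage is an interior point,
          which still forces the indices to agree.\<close>
        have "j = j'"
          using little_disk_disjoint [OF f 2(1) that(1) z b] 2(3) eq by simp
        then have "z = g j (i, w)"
          using little_disk_inj [OF f 2(1) z] b eq 2(3) by auto
        then show False
          using 2(2) that(2,3) unfolding \<open>j = j'\<close> mem_disk_complement_iff by blast
      qed
      then show ?thesis
        unfolding L using little_disk_in_cball [OF f 2(1) z] 2(3) by blast
    qed
  qed
qed

section \<open>The topology of the spaces of little disks\<close>

lemma continuous_map_scaleR [continuous_intros]:
  fixes g :: "'x \<Rightarrow> 'b::real_normed_vector"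
  assumes "continuous_map X euclideanreal f" "continuous_map X euclidean g"
  shows "continuous_map X euclidean (\<lambda>x. f x *\<^sub>R g x)"
  using assms by (simp add: continuous_map_atin tendsto_scaleR)

lemma continuous_map_disk_centre:
  assumes "k < r"
  shows "continuous_map (little_disks r) euclidean (\<lambda>f. disk_centre f k)"
  unfolding disk_centre_def using assms by (intro continuous_map_little_disks_eval) auto

lemma continuous_map_disk_radius:
  assumes "k < r"
  shows "continuous_map (little_disks r) euclideanreal (\<lambda>f. disk_radius (f :: ('a::euclidean_space) config) k)"
  unfolding disk_radius_def using assms
  by (intro continuous_intros continuous_map_little_disks_eval) (auto simp: norm_SOME_Basis)

text \<open>Centre and radius come from evaluations at two points, and their variation bounds that
  of the whole disk uniformly. Subbasic sets of the compact-open topology are therefore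
  neighbourhoods already for pointwise convergence.\<close>

lemma continuous_map_little_disksI:
  fixes F :: "'y \<Rightarrow> ('a::euclidean_space) config"
  assumes in_disks: "\<And>y. y \<in> topspace Y \<Longrightarrow> F y \<in> topspace (little_disks r)"
    and cont: "\<And>k z. k < r \<Longrightarrow> z \<in> cball 0 1 \<Longrightarrow> continuous_map Y euclidean (\<lambda>y. F y (k, z))"
  shows "continuous_map Y (little_disks r) F"
proof -
  let ?X = "sum_topology (\<lambda>k. top_of_set (cball (0::'a) 1)) {..<r}"
  let ?D = "top_of_set (cball (0::'a) 1)"
  have F: "F y \<in> extensional (topspace ?X) \<and> continuous_map ?X ?D (F y)" if "y \<in> topspace Y" for y
    using in_disks [OF that] unfolding little_disks_def topspace_subtopology topspace_compact_open by blast
  have radius: "continuous_map Y euclideanreal (\<lambda>y. disk_radius (F y) k)" if "k < r" for k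
    unfolding disk_radius_def using that
    by (intro continuous_intros cont) (auto simp: norm_SOME_Basis)
  have centre: "continuous_map Y euclidean (\<lambda>y. disk_centre (F y) k)" if "k < r" for k
    unfolding disk_centre_def using that by (intro cont) auto
  have "continuous_map Y (compact_open ?X ?D) F"
    unfolding compact_open_def
  proof (rule continuous_on_generated_topo)
    fix W assume "W \<in> {{f \<in> extensional (topspace ?X). continuous_map ?X ?D f \<and> f ` K \<subseteq> U} | K U.
        compactin ?X K \<and> openin ?D U}"
    then obtain K U where K: "compactin ?X K" and U: "openin ?D U"
      and W: "W = {f \<in> extensional (topspace ?X). continuous_map ?X ?D f \<and> f ` K \<subseteq> U}"
      by blast
    obtain V where V: "open V" "U = cball 0 1 \<inter> V"
      using U by (auto simp: openin_open)
    have KX: "K \<subseteq> {..<r} \<times> cball 0 1"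
      using compactin_subset_topspace [OF K] by auto
    have "F -` W \<inter> topspace Y = {y \<in> topspace Y. F y ` K \<subseteq> U}"
      using F unfolding W by blast
    moreover have "openin Y {y \<in> topspace Y. F y ` K \<subseteq> U}"
    proof (subst openin_subopen, intro ballI)
      fix y0 assume "y0 \<in> {y \<in> topspace Y. F y ` K \<subseteq> U}"
      then have y0: "y0 \<in> topspace Y" and K0: "F y0 ` K \<subseteq> U" by auto
      have "compactin ?D (F y0 ` K)"
        using F [OF y0] K image_compactin by blast
      then have "compact (F y0 ` K)"
        by (simp add: compactin_subtopology)
      moreover have "F y0 ` K \<subseteq> V"
        using K0 V(2) by blast
      ultimately obtain e where e: "e > 0" "(\<Union>w\<in>F y0 ` K. ball w e) \<subseteq> V"
        using compact_subset_open_imp_ball_epsilon_subset [OF _ V(1)] by metis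
      \<comment> \<open>Bounds the displacement of every point of the \<open>k\<close>-th disk,
        since points of the unit ball have norm at most 1. Summing over \<open>k\<close> gives one
        continuous function that dominates all disks and is 0 for \<open>r = 0\<close>.\<close>
      define d where "d k y = \<bar>disk_radius (F y) k - disk_radius (F y0) k\<bar> +
          norm (disk_centre (F y) k - disk_centre (F y0) k)" for k y
      have "continuous_map Y euclideanreal (\<lambda>y. \<Sum>k<r. d k y)"
        unfolding d_def real_norm_def [symmetric]
        by (intro continuous_map_sum continuous_intros radius centre) auto
      then have "openin Y {y \<in> topspace Y. (\<Sum>k<r. d k y) \<in> {..<e}}" (is "openin Y ?N")
        by (rule openin_continuous_map_preimage) auto
      moreover have "y0 \<in> ?N"
        using e(1) y0 by (simp add: d_def)
      moreover have "?N \<subseteq> {y \<in> topspace Y. F y ` K \<subseteq> U}"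
      proof
        fix y assume y: "y \<in> ?N"
        then have yY: "y \<in> topspace Y" by blast
        have "F y (k, x) \<in> U" if "(k, x) \<in> K" for k x
        proof -
          have kx: "k < r" "x \<in> cball 0 1"
            using that KX by auto
          have "F y (k, x) - F y0 (k, x) = (disk_radius (F y) k - disk_radius (F y0) k) *\<^sub>R x +
                 (disk_centre (F y) k - disk_centre (F y0) k)"
            unfolding little_disk_eq [OF in_disks [OF yY] kx] little_disk_eq [OF in_disks [OF y0] kx]
            by (simp add: algebra_simps)
          then have "norm (F y (k, x) - F y0 (k, x)) \<le>
              \<bar>disk_radius (F y) k - disk_radius (F y0) k\<bar> * norm x +
              norm (disk_centre (F y) k - disk_centre (F y0) k)"
            by (metis norm_scaleR norm_triangle_ineq)
          also have "\<dots> \<le> d k y"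
            using kx(2) by (simp add: d_def mult_left_le)
          also have "\<dots> \<le> (\<Sum>k<r. d k y)"
            using kx(1) by (intro member_le_sum) (auto simp: d_def)
          also have "\<dots> < e"
            using y by simp
          finally have "F y (k, x) \<in> ball (F y0 (k, x)) e"
            by (simp add: dist_norm norm_minus_commute)
          then have "F y (k, x) \<in> V"
            using e(2) that by blast
          then show ?thesis
            using V(2) little_disk_in_cball [OF in_disks [OF yY] kx] by blast
        qed
        with yY show "y \<in> {y \<in> topspace Y. F y ` K \<subseteq> U}" by auto
      qed
      ultimately show "\<exists>N. openin Y N \<and> y0 \<in> N \<and> N \<subseteq> {y \<in> topspace Y. F y ` K \<subseteq> U}"
        by blast
    qed
    ultimately show "openin Y (F -` W \<inter> topspace Y)" by simp
  next
    have "F y \<in> topspace (compact_open ?X ?D)" if "y \<in> topspace Y" for y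
      using F [OF that] unfolding topspace_compact_open by blast
    then show "F ` topspace Y \<subseteq> \<Union> {{f \<in> extensional (topspace ?X). continuous_map ?X ?D f \<and> f ` K \<subseteq> U} | K U.
        compactin ?X K \<and> openin ?D U}"
      unfolding compact_open_def topology_generated_by_topspace by blast
  qed
  then show ?thesis
    using in_disks unfolding little_disks_def continuous_map_in_subtopology topspace_subtopology by blast
qed

section \<open>Continuity of relabelling and composition of configurations\<close>

lemma continuous_map_little_disks_act:
  assumes "\<sigma> permutes {..<r}"
  shows "continuous_map (little_disks r) (little_disks r)
           (little_disks_act r \<sigma> :: ('a::euclidean_space) config \<Rightarrow> 'a config)"
proof (rule continuous_map_little_disksI)
  have \<sigma>: "\<sigma> k < r" if "k < r" for k
    using permutes_in_image [OF assms] that by blast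
  have inj: "k = l" if "\<sigma> k = \<sigma> l" for k l
    using permutes_inj [OF assms] that by (rule injD)
  show "little_disks_act r \<sigma> f \<in> topspace (little_disks r)"
    if "f \<in> topspace (little_disks r)" for f :: "'a config"
    using that \<sigma> inj unfolding topspace_little_disks_iff
    by (simp add: little_disks_act_def Ball_def)
  show "continuous_map (little_disks r) euclidean (\<lambda>f :: 'a config. little_disks_act r \<sigma> f (k, z))"
    if "k < r" "z \<in> cball 0 1" for k z
    using that \<sigma> by (auto simp: little_disks_act_def intro!: continuous_map_little_disks_eval)
qed

lemma disk_complement_little_disks_act:
  assumes "\<sigma> permutes {..<r}"
  shows "disk_complement r (little_disks_act r \<sigma> f) = disk_complement r f"
proof -
  have "(\<lambda>x. little_disks_act r \<sigma> f (k, x)) ` ball 0 1 = (\<lambda>x. f (\<sigma> k, x)) ` ball 0 1" if "k < r" for k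
    using that by (auto simp: little_disks_act_def)
  then have "(\<Union>k<r. (\<lambda>x. little_disks_act r \<sigma> f (k, x)) ` ball 0 1) = (\<Union>k\<in>\<sigma> ` {..<r}. (\<lambda>x. f (k, x)) ` ball 0 1)"
    by simp
  then show ?thesis
    unfolding disk_complement_def permutes_image [OF assms] by simp
qed

text \<open>For fixed \<open>z\<close> the composite evaluates \<open>F y\<close> at the moving
  point \<open>G y j (i, z)\<close>. The affine formula turns this into an expression in the radius,
  the centre and that point, each continuous in \<open>y\<close>, so pointwise evaluations
  suffice.\<close>

lemma continuous_map_little_disks_comp:
  fixes F :: "'y \<Rightarrow> ('a::euclidean_space) config"
  assumes F: "continuous_map Y (little_disks (length ns)) F"
    and G: "\<And>j. j < length ns \<Longrightarrow> continuous_map Y (little_disks (ns ! j)) (\<lambda>y. G y j)"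
  shows "continuous_map Y (little_disks (sum_list ns)) (\<lambda>y. little_disks_comp ns (F y) (G y))"
proof (rule continuous_map_little_disksI)
  have Fy: "F y \<in> topspace (little_disks (length ns))" if "y \<in> topspace Y" for y
    using continuous_map_image_subset_topspace [OF F] that by blast
  have Gy: "G y j \<in> topspace (little_disks (ns ! j))" if "y \<in> topspace Y" "j < length ns" for y j
    using continuous_map_image_subset_topspace [OF G [OF that(2)]] that(1) by blast
  show "little_disks_comp ns (F y) (G y) \<in> topspace (little_disks (sum_list ns))"
    if "y \<in> topspace Y" for y
    using Fy Gy that by (intro little_disks_comp_in) auto
  fix k z assume "k < sum_list ns" and z: "z \<in> cball (0::'a) 1"
  then obtain j i where ji: "j < length ns" "i < ns ! j" "k = block_offset ns j + i"
    by (auto elim: block_offset_cases)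
  have "continuous_map Y euclidean (\<lambda>y. disk_radius (F y) j *\<^sub>R G y j (i, z) + disk_centre (F y) j)"
    using continuous_map_compose [OF F continuous_map_disk_radius [OF ji(1)]]
      continuous_map_compose [OF F continuous_map_disk_centre [OF ji(1)]]
      continuous_map_compose [OF G [OF ji(1)] continuous_map_little_disks_eval [OF ji(2) z]]
    by (intro continuous_intros) (simp_all add: o_def)
  moreover have "disk_radius (F y) j *\<^sub>R G y j (i, z) + disk_centre (F y) j =
      little_disks_comp ns (F y) (G y) (k, z)" if "y \<in> topspace Y" for y
    unfolding ji(3) little_disks_comp_apply [OF ji(1,2) z]
    using little_disk_eq [OF Fy [OF that] ji(1) little_disk_in_cball [OF Gy [OF that ji(1)] ji(2) z]] by simp
  ultimately show "continuous_map Y euclidean (\<lambda>y. little_disks_comp ns (F y) (G y) (k, z))"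
    by (rule continuous_map_eq)
qed

section \<open>The topology of the spaces \<open>W\<^sub>n\<^sup>T(r)\<close>\<close>

text \<open>The fibre product of \<open>W_space r\<close> with \<open>Y\<close> over the space of
  configurations, without the coordinate \<open>f\<close>, which \<open>y\<close> determines. As a
  subspace of \<open>Y\<close> times the unit ball it admits the projection along a compact
  factor.\<close>

definition complement_bundle ::
  "nat \<Rightarrow> 'y topology \<Rightarrow> ('y \<Rightarrow> ('a::euclidean_space) config) \<Rightarrow> ('y \<times> 'a) topology" where
  "complement_bundle r Y F =
     subtopology (prod_topology Y (top_of_set (cball 0 1))) {(y, x). x \<in> disk_complement r (F y)}"

lemma topspace_complement_bundle:
  "topspace (complement_bundle r Y F) = (SIGMA y:topspace Y. disk_complement r (F y))"
  using disk_complement_subset unfolding complement_bundle_def topspace_subtopology by fastforce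

lemma continuous_map_complement_bundle_base:
  "continuous_map (complement_bundle r Y F) Y fst"
  unfolding complement_bundle_def by (intro continuous_map_from_subtopology continuous_map_fst)

lemma continuous_map_complement_bundle_point:
  "continuous_map (complement_bundle r Y F) (top_of_set (cball 0 1)) snd"
  unfolding complement_bundle_def by (intro continuous_map_from_subtopology continuous_map_snd)

lemma continuous_map_into_complement_bundle:
  assumes "continuous_map X Y f" "continuous_map X euclidean g"
    and "\<And>x. x \<in> topspace X \<Longrightarrow> g x \<in> disk_complement r (F (f x))"
  shows "continuous_map X (complement_bundle r Y F) (\<lambda>x. (f x, g x))"
  using assms disk_complement_subset
  unfolding complement_bundle_def continuous_map_in_subtopology by (fastforce simp: continuous_map_paired continuous_map_in_subtopology)

text \<open>Pulled back from the closedness of \<open>W_space r\<close>. It is used in two places: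
  to project bad points along the compact ball, and to make the outer piece of a glued map
  closed.\<close>

lemma closedin_complement_bundle:
  fixes F :: "'y \<Rightarrow> ('a::euclidean_space) config"
  assumes "continuous_map Y (little_disks r) F"
  shows "closedin (prod_topology Y (top_of_set (cball 0 1))) (topspace (complement_bundle r Y F))"
proof -
  let ?P = "prod_topology Y (top_of_set (cball (0::'a) 1))"
  let ?LD = "prod_topology (little_disks r) (top_of_set (cball (0::'a) 1))"
  have c: "continuous_map ?P ?LD (\<lambda>z. (F (fst z), snd z))"
    using continuous_map_compose [OF continuous_map_fst assms]
    by (intro continuous_map_pairedI continuous_map_snd) (simp add: o_def)
  have "topspace (complement_bundle r Y F) = {z \<in> topspace ?P. (F (fst z), snd z) \<in>
           {p \<in> topspace ?LD. snd p \<in> disk_complement r (fst p)}}"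
    using continuous_map_image_subset_topspace [OF c] disk_complement_subset
    unfolding topspace_complement_bundle by (fastforce simp: mem_Times_iff)
  then show ?thesis
    using closedin_continuous_map_preimage [OF c closedin_W_space] by simp
qed

text \<open>Dropping the coordinate \<open>f\<close> of the fibre product, or restoring it as
  \<open>fst (g y)\<close>, is continuous in both directions. Continuity of each single \<xi> is
  recovered by restricting the joint map to the fibre over \<open>y\<close>, embedded by x \<mapsto>
  (y, x).\<close>

lemma WT_test_map_iff:
  fixes g :: "'y \<Rightarrow> ('a::euclidean_space) config \<times> ('a \<Rightarrow> 't)"
  shows "WT_test_map r T Y g \<longleftrightarrow>
    (\<forall>y\<in>topspace Y. snd (g y) \<in> extensional (disk_complement r (fst (g y)))) \<and>
    continuous_map Y (little_disks r) (\<lambda>y. fst (g y)) \<and>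
    continuous_map (complement_bundle r Y (\<lambda>y. fst (g y))) T (\<lambda>(y, x). snd (g y) x)"
    (is "?L \<longleftrightarrow> ?E \<and> ?C \<and> ?X")
proof -
  let ?B = "complement_bundle r Y (\<lambda>y. fst (g y))"
  let ?W = "subtopology (prod_topology (W_space r) Y) {((f, x), y). f = fst (g y)}"
  have XW: "?X \<longleftrightarrow> continuous_map ?W T (\<lambda>((f, x), y). snd (g y) x)" (is "_ \<longleftrightarrow> ?Y") if C: ?C
  proof
    assume X: ?X
    have 1: "continuous_map (W_space r) euclidean (snd :: 'a config \<times> 'a \<Rightarrow> 'a)"
      unfolding W_space_def
      using continuous_map_snd [of "little_disks r" "top_of_set (cball (0::'a) 1)"]
        continuous_map_into_fulltopology continuous_map_from_subtopology by blast
    have "continuous_map ?W ?B (\<lambda>w. (snd w, snd (fst w)))"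
    proof (rule continuous_map_into_complement_bundle)
      show "continuous_map ?W Y snd"
        by (intro continuous_map_from_subtopology continuous_map_snd)
      show "continuous_map ?W euclidean (\<lambda>w. snd (fst w))"
        using continuous_map_compose [OF continuous_map_fst 1]
        by (intro continuous_map_from_subtopology) (simp add: o_def)
    qed (auto simp: W_space_def)
    from continuous_map_compose [OF this X] show ?Y
      by (simp add: o_def case_prod_beta')
  next
    assume Y: ?Y
    have c: "continuous_map ?B (little_disks r) (\<lambda>w. fst (g (fst w)))"
      using continuous_map_compose [OF continuous_map_complement_bundle_base C] by (simp add: o_def)
    have "continuous_map ?B (W_space r) (\<lambda>w. (fst (g (fst w)), snd w))"
      unfolding W_space_def continuous_map_in_subtopology
      by (intro conjI continuous_map_pairedI c continuous_map_complement_bundle_point)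
         (auto simp: topspace_complement_bundle)
    then have "continuous_map ?B ?W (\<lambda>w. ((fst (g (fst w)), snd w), fst w))"
      unfolding continuous_map_in_subtopology
      by (intro conjI continuous_map_pairedI continuous_map_complement_bundle_base) auto
    from continuous_map_compose [OF this Y] show ?X
      by (simp add: o_def case_prod_beta')
  qed
  have "g y \<in> WT_points r T" if ?E ?C ?X and y: "y \<in> topspace Y" for y
  proof -
    have "continuous_map (top_of_set (disk_complement r (fst (g y)))) ?B (\<lambda>x. (y, x))"
      using y by (intro continuous_map_into_complement_bundle continuous_map_from_subtopology) auto
    from continuous_map_compose [OF this \<open>?X\<close>]
    have "continuous_map (top_of_set (disk_complement r (fst (g y)))) T (snd (g y))"
      by (simp add: o_def)
    moreover have "fst (g y) \<in> topspace (little_disks r)"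
      using \<open>?C\<close> y continuous_map_image_subset_topspace by blast
    ultimately show ?thesis
      using \<open>?E\<close> y by (simp add: WT_points_def case_prod_beta)
  qed
  moreover have "?E" if "g \<in> topspace Y \<rightarrow> WT_points r T"
    using that by (auto simp: WT_points_def Pi_iff case_prod_beta)
  ultimately show ?thesis
    unfolding WT_test_map_def using XW by blast
qed

lemma WT_test_map_compose:
  assumes g: "WT_test_map r T Y g" and h: "continuous_map X Y h"
  shows "WT_test_map r T X (\<lambda>x. g (h x))"
  unfolding WT_test_map_iff
proof (intro conjI ballI)
  fix x assume "x \<in> topspace X"
  then have "h x \<in> topspace Y"
    using continuous_map_image_subset_topspace [OF h] by blast
  then show "snd (g (h x)) \<in> extensional (disk_complement r (fst (g (h x))))"
    using g by (simp add: WT_test_map_iff)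
next
  show "continuous_map X (little_disks r) (\<lambda>x. fst (g (h x)))"
    using g continuous_map_compose [OF h] by (force simp: WT_test_map_iff o_def)
  have "continuous_map (complement_bundle r X (\<lambda>x. fst (g (h x)))) (complement_bundle r Y (\<lambda>y. fst (g y)))
          (\<lambda>w. (h (fst w), snd w))"
    using continuous_map_compose [OF continuous_map_complement_bundle_base h]
      continuous_map_into_fulltopology [OF continuous_map_complement_bundle_point]
    by (intro continuous_map_into_complement_bundle) (auto simp: o_def topspace_complement_bundle)
  moreover have "continuous_map (complement_bundle r Y (\<lambda>y. fst (g y))) T (\<lambda>(y, x). snd (g y) x)"
    using g by (simp add: WT_test_map_iff)
  ultimately have "continuous_map (complement_bundle r X (\<lambda>x. fst (g (h x)))) T
      ((\<lambda>(y, x). snd (g y) x) \<circ> (\<lambda>w. (h (fst w), snd w)))"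
    by (rule continuous_map_compose)
  then show "continuous_map (complement_bundle r X (\<lambda>x. fst (g (h x)))) T (\<lambda>(x, z). snd (g (h x)) z)"
    by (simp add: o_def case_prod_beta')
qed

text \<open>
  Projections along the compact set \<open>K\<close> are closed, so these sets are open in the source of every
  test map.
\<close>

lemma openin_WT_space_compact:
  fixes K :: "('a::euclidean_space) set" and T :: "'t topology"
  assumes K: "compact K" "K \<subseteq> cball 0 1" and U: "openin T U"
  shows "openin (WT_space r T) {p \<in> WT_points r T. \<forall>x\<in>K \<inter> disk_complement r (fst p). snd p x \<in> U}"
  unfolding openin_WT_space
proof (intro conjI allI impI)
  fix Y :: "('a config \<times> ('a \<Rightarrow> 't)) topology" and g :: "'a config \<times> ('a \<Rightarrow> 't) \<Rightarrow> 'a config \<times> ('a \<Rightarrow> 't)"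
  assume g: "WT_test_map r T Y g"
  let ?B = "complement_bundle r Y (\<lambda>y. fst (g y))"
  let ?P = "prod_topology Y (top_of_set (cball (0::'a) 1))"
  have ev: "continuous_map ?B T (\<lambda>(y, x). snd (g y) x)"
    and fst: "continuous_map Y (little_disks r) (\<lambda>y. fst (g y))"
    using g by (simp_all add: WT_test_map_iff)
  \<comment> \<open>The points (y, x) whose value misses \<open>U\<close>. Its part over
    \<open>K\<close> projects onto the complement of the set that is to be open.\<close>
  define D where "D = {z \<in> topspace ?B. (\<lambda>(y, x). snd (g y) x) z \<in> topspace T - U}"
  have "closedin ?B D"
    unfolding D_def using U by (intro closedin_continuous_map_preimage [OF ev]) blast
  moreover have "?B = subtopology ?P (topspace ?B)"
    unfolding complement_bundle_def topspace_subtopology by (simp only: subtopology_restrict)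
  ultimately have D: "closedin ?P D"
    using closedin_complement_bundle [OF fst] closedin_trans_full by metis
  have "closedin ?P (topspace Y \<times> K)"
    using K by (auto simp: closedin_prod_Times_iff closedin_subset_topspace compact_imp_closed closed_subset)
  then have "closedin ?P (D \<inter> topspace Y \<times> K)"
    using D by blast
  moreover have "closed_map ?P Y fst"
    by (intro Abstract_Topological_Spaces.closed_map_fst) (simp add: compact_space_subtopology)
  ultimately have "closedin Y (fst ` (D \<inter> topspace Y \<times> K))"
    by (simp add: closed_map_def)
  moreover have "{y \<in> topspace Y. g y \<in> {p \<in> WT_points r T. \<forall>x\<in>K \<inter> disk_complement r (fst p). snd p x \<in> U}} =
      topspace Y - fst ` (D \<inter> topspace Y \<times> K)" (is "?l = ?r")
  proof -
    have g_in: "g y \<in> WT_points r T" if "y \<in> topspace Y" for y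
      using g that by (auto simp: WT_test_map_def)
    have T: "snd (g y) x \<in> topspace T" if "y \<in> topspace Y" "x \<in> disk_complement r (fst (g y))" for x y
      using g_in [OF that(1)] that(2) by (auto simp: WT_points_def continuous_map_def)
    have D_iff: "(y, x) \<in> D \<longleftrightarrow> x \<in> disk_complement r (fst (g y)) \<and> snd (g y) x \<notin> U"
      if "y \<in> topspace Y" for x y
      using that T [OF that, of x] by (auto simp: D_def topspace_complement_bundle)
    define E where "E = fst ` (D \<inter> topspace Y \<times> K)"
    have "y \<in> E \<longleftrightarrow> (\<exists>x\<in>K \<inter> disk_complement r (fst (g y)). snd (g y) x \<notin> U)"
      if y: "y \<in> topspace Y" for y
    proof -
      have "y \<in> E \<longleftrightarrow> (\<exists>x. (y, x) \<in> D \<and> x \<in> K)"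
        using y unfolding E_def by (auto simp del: split_paired_All split_paired_Ex intro: rev_image_eqI)
      then show ?thesis
        using D_iff [OF y] by blast
    qed
    then show ?thesis
      using g_in unfolding E_def [symmetric] by blast
  qed
  ultimately show "openin Y ?l" by auto
qed auto

text \<open>The substance is that evaluation is continuous jointly in (f, \<xi>) and x. Near a given
  point, x is confined to a small compact ball \<open>K\<close>, and the condition that \<xi> maps
  the part of \<open>K\<close> in its domain into \<open>U\<close> is open. It constrains nearby
  configurations too, whose complements may meet \<open>K\<close> differently.\<close>

lemma WT_test_map_ident:
  fixes T :: "'t topology"
  shows "WT_test_map r T (WT_space r T) (\<lambda>p :: ('a::euclidean_space) config \<times> ('a \<Rightarrow> 't). p)"
  unfolding WT_test_map_iff
proof (intro conjI ballI)
  let ?W = "WT_space r T :: ('a config \<times> ('a \<Rightarrow> 't)) topology"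
  show "snd p \<in> extensional (disk_complement r (fst p))" if "p \<in> topspace ?W" for p
    using that by (auto simp: WT_points_def)
  show "continuous_map ?W (little_disks r) fst"
    unfolding continuous_map_def
  proof (intro conjI allI impI)
    show "fst \<in> topspace ?W \<rightarrow> topspace (little_disks r)"
      by (auto simp: WT_points_def)
    fix V :: "'a config set" assume V: "openin (little_disks r) V"
    show "openin ?W {p \<in> topspace ?W. fst p \<in> V}"
      unfolding openin_WT_space
    proof (intro conjI allI impI)
      fix Y :: "('a config \<times> ('a \<Rightarrow> 't)) topology" and g :: "'a config \<times> ('a \<Rightarrow> 't) \<Rightarrow> 'a config \<times> ('a \<Rightarrow> 't)"
      assume g: "WT_test_map r T Y g"
      then have "{y \<in> topspace Y. g y \<in> {p \<in> topspace ?W. fst p \<in> V}} = {y \<in> topspace Y. fst (g y) \<in> V}"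
        by (auto simp: WT_test_map_def)
      moreover have "openin Y \<dots>"
        using g V by (intro openin_continuous_map_preimage) (auto simp: WT_test_map_def)
      ultimately show "openin Y {y \<in> topspace Y. g y \<in> {p \<in> topspace ?W. fst p \<in> V}}" by simp
    qed auto
  qed
  let ?B = "complement_bundle r ?W fst"
  show "continuous_map ?B T (\<lambda>(p, x). snd p x)"
    unfolding continuous_map_def
  proof (intro conjI allI impI)
    show "(\<lambda>(p, x). snd p x) \<in> topspace ?B \<rightarrow> topspace T"
      by (auto simp: topspace_complement_bundle WT_points_def continuous_map_def)
    fix U assume U: "openin T U"
    show "openin ?B {z \<in> topspace ?B. (\<lambda>(p, x). snd p x) z \<in> U}"
    proof (subst openin_subopen, intro ballI)
      fix z assume "z \<in> {z \<in> topspace ?B. (\<lambda>(p, x). snd p x) z \<in> U}"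
      then obtain f \<xi> x where z: "z = ((f, \<xi>), x)" and p: "(f, \<xi>) \<in> WT_points r T"
        and x: "x \<in> disk_complement r f" and xU: "\<xi> x \<in> U"
        by (auto simp: topspace_complement_bundle)
      have "continuous_map (top_of_set (disk_complement r f)) T \<xi>"
        using p by (simp add: WT_points_def)
      then have "openin (top_of_set (disk_complement r f)) {x \<in> disk_complement r f. \<xi> x \<in> U}"
        using openin_continuous_map_preimage [OF _ U] by force
      then obtain e where e: "e > 0" "\<And>y. y \<in> disk_complement r f \<Longrightarrow> dist y x < e \<Longrightarrow> \<xi> y \<in> U"
        using x xU unfolding openin_euclidean_subtopology_iff by blast
      \<comment> \<open>Half of \<open>e\<close> keeps the closed ball inside the open
        \<open>e\<close>-ball on which \<xi> is known to stay in \<open>U\<close>; the second factor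
        keeps \<open>K\<close> inside the unit ball.\<close>
      define K where "K = cball x (e/2) \<inter> cball 0 1"
      define N where "N = {p \<in> WT_points r T. \<forall>x\<in>K \<inter> disk_complement r (fst p). snd p x \<in> U}"
      have N: "openin ?W N"
        unfolding N_def using U by (intro openin_WT_space_compact) (auto simp: K_def compact_Int)
      define Q where "Q = {z \<in> topspace ?B. fst z \<in> N} \<inter> {z \<in> topspace ?B. snd z \<in> ball x (e/2)}"
      have "openin ?B Q"
        unfolding Q_def
      proof (rule openin_Int)
        show "openin ?B {z \<in> topspace ?B. fst z \<in> N}"
          using continuous_map_complement_bundle_base N by (rule openin_continuous_map_preimage)
        show "openin ?B {z \<in> topspace ?B. snd z \<in> ball x (e/2)}"
          using continuous_map_into_fulltopology [OF continuous_map_complement_bundle_point]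
          by (rule openin_continuous_map_preimage) simp
      qed
      moreover have "z \<in> Q"
        using e p x by (auto simp: Q_def N_def K_def z topspace_complement_bundle dist_commute)
      moreover have "Q \<subseteq> {z \<in> topspace ?B. (\<lambda>(p, x). snd p x) z \<in> U}"
      proof
        fix w assume "w \<in> Q"
        then obtain q y where w: "w = (q, y)" "w \<in> topspace ?B" "q \<in> N" "y \<in> ball x (e/2)"
          unfolding Q_def by (cases w) auto
        then have "y \<in> disk_complement r (fst q)"
          by (simp add: topspace_complement_bundle)
        moreover from this have "y \<in> K"
          using w(4) disk_complement_subset unfolding K_def by (fastforce simp: subset_iff)
        ultimately show "w \<in> {z \<in> topspace ?B. (\<lambda>(p, x). snd p x) z \<in> U}"
          using w by (auto simp: N_def)
      qed
      ultimately show "\<exists>Q. openin ?B Q \<and> z \<in> Q \<and> Q \<subseteq> {z \<in> topspace ?B. (\<lambda>(p, x). snd p x) z \<in> U}"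
        by blast
    qed
  qed
qed

text \<open>A universal property for maps into the space, where the definition only provides one for
  maps out of it. A continuous \<open>g\<close> is a test map because it is the pullback of the
  universal family, the identity, along itself. Sources such as products of these spaces need no
  separate study after this.\<close>

lemma continuous_map_WT_space_iff:
  "continuous_map Y (WT_space r T) g \<longleftrightarrow> WT_test_map r T Y g"
  using continuous_map_WT_test_map WT_test_map_compose [OF WT_test_map_ident] by blast

section \<open>Gluing\<close>

lemma mem_topspace_ET_space:
  fixes p :: "('a::euclidean_space) config \<times> ('a \<Rightarrow> 't)"
  shows "p \<in> topspace (ET_space T \<psi> \<phi>s) \<longleftrightarrow>
    p \<in> WT_points (length \<phi>s) T \<and>
    (\<forall>k<length \<phi>s. \<forall>z\<in>sphere 0 1. snd p (fst p (k, z)) = (\<phi>s ! k) z) \<and>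
    (\<forall>z\<in>sphere 0 1. snd p z = \<psi> z)"
  unfolding ET_space_def by (simp add: case_prod_beta)

lemma continuous_map_ET_space_iff:
  fixes g :: "'y \<Rightarrow> ('a::euclidean_space) config \<times> ('a \<Rightarrow> 't)"
  shows "continuous_map Y (ET_space T \<psi> \<phi>s) g \<longleftrightarrow> WT_test_map (length \<phi>s) T Y g \<and>
    (\<forall>y\<in>topspace Y.
      (\<forall>k<length \<phi>s. \<forall>z\<in>sphere 0 1. snd (g y) (fst (g y) (k, z)) = (\<phi>s ! k) z) \<and>
      (\<forall>z\<in>sphere 0 1. snd (g y) z = \<psi> z))"
  unfolding ET_space_def continuous_map_in_subtopology continuous_map_WT_space_iff
  by (auto simp: case_prod_beta Pi_iff)

lemma ET_spaceD:
  fixes p :: "('a::euclidean_space) config \<times> ('a \<Rightarrow> 't)"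
  assumes "p \<in> topspace (ET_space T \<psi> \<phi>s)"
  shows "fst p \<in> topspace (little_disks (length \<phi>s))"
    and "snd p \<in> extensional (disk_complement (length \<phi>s) (fst p))"
    and "k < length \<phi>s \<Longrightarrow> z \<in> sphere 0 1 \<Longrightarrow> snd p (fst p (k, z)) = (\<phi>s ! k) z"
    and "z \<in> sphere 0 1 \<Longrightarrow> snd p z = \<psi> z"
  using assms unfolding mem_topspace_ET_space by (auto simp: WT_points_def)

lemma little_disks_extensional:
  "f \<in> topspace (little_disks r) \<Longrightarrow> f \<in> extensional ({..<r} \<times> cball 0 1)"
  unfolding topspace_little_disks_iff by blast

section \<open>Identities and symmetric group actions\<close>

lemma disk_complement_id: "disk_complement (Suc 0) little_disks_id = sphere (0::'a::euclidean_space) 1"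
proof -
  have "(\<lambda>x :: 'a. little_disks_id (0, x)) ` ball 0 1 = ball 0 1"
    by (auto simp: little_disks_id_def image_iff)
  then show ?thesis
    by (auto simp: disk_complement_def)
qed

lemma ET_id_in:
  assumes "\<phi> \<in> sphere_maps T"
  shows "ET_id (\<phi> :: 'a::euclidean_space \<Rightarrow> 't) \<in> topspace (ET_space T \<phi> [\<phi>])"
proof -
  have "\<forall>x\<in>cball 0 1. little_disks_id (0, x) = 1 *\<^sub>R x + (0::'a)"
    by (simp add: little_disks_id_def)
  then have "little_disks_id \<in> topspace (little_disks (Suc 0) :: 'a config topology)"
    unfolding topspace_little_disks_iff less_Suc0
    by (auto simp: little_disks_id_def intro: zero_less_one)
  with assms show ?thesis
    by (auto simp: mem_topspace_ET_space WT_points_def ET_id_def disk_complement_id sphere_maps_def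
        little_disks_id_def [THEN fun_cong])
qed

text \<open>Relabelling the disks changes neither the complement nor \<xi>. The bundles of
  complements before and after coincide, with the same evaluation map, and only the configuration
  has to be examined.\<close>

lemma continuous_map_ET_act:
  fixes \<phi>s :: "('a::euclidean_space \<Rightarrow> 't) list"
  assumes \<sigma>: "\<sigma> permutes {..<length \<phi>s}"
  shows "continuous_map (ET_space T \<psi> \<phi>s) (ET_space T \<psi> (permute_list \<sigma> \<phi>s)) (ET_act \<psi> \<phi>s \<sigma>)"
proof -
  let ?E = "ET_space T \<psi> \<phi>s" and ?r = "length \<phi>s"
  have \<sigma>_less: "\<sigma> k < ?r" if "k < ?r" for k
    using permutes_in_image [OF \<sigma>] that by blast
  have "continuous_map ?E ?E (\<lambda>p. p)" by simp
  then have id: "WT_test_map ?r T ?E (\<lambda>p. p)"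
    unfolding continuous_map_ET_space_iff by blast
  then have "continuous_map ?E (little_disks ?r) (\<lambda>p. little_disks_act ?r \<sigma> (fst p))"
    using continuous_map_compose [OF _ continuous_map_little_disks_act [OF \<sigma>]]
    by (fastforce simp: WT_test_map_iff o_def)
  moreover have "complement_bundle ?r ?E (\<lambda>p. little_disks_act ?r \<sigma> (fst p)) =
      complement_bundle ?r ?E fst"
    unfolding complement_bundle_def disk_complement_little_disks_act [OF \<sigma>] ..
  ultimately have "WT_test_map ?r T ?E (\<lambda>p. (little_disks_act ?r \<sigma> (fst p), snd p))"
    using id by (simp add: WT_test_map_iff disk_complement_little_disks_act [OF \<sigma>])
  moreover have "snd p (little_disks_act ?r \<sigma> (fst p) (k, z)) = (permute_list \<sigma> \<phi>s ! k) z"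
    if "p \<in> topspace ?E" "k < ?r" "z \<in> sphere 0 1" for p k z
    using that ET_spaceD(3) [OF that(1) \<sigma>_less]
    by (simp add: little_disks_act_def permute_list_nth [OF \<sigma>])
  ultimately show ?thesis
    unfolding continuous_map_ET_space_iff by (simp add: ET_act_def case_prod_beta' ET_spaceD(4))
qed

text \<open>The data of one single composition. Proofs of the axioms interpret it once for each
  composite involved; a family of compositions satisfies it at each parameter.\<close>

locale ET_composable =
  fixes T :: "'t topology" and \<psi> :: "'a::euclidean_space \<Rightarrow> 't" and \<phi>s \<theta>ss p q
  assumes p: "p \<in> topspace (ET_space T \<psi> \<phi>s)"
    and len: "length \<theta>ss = length \<phi>s"
    and q: "\<And>j. j < length \<phi>s \<Longrightarrow> q j \<in> topspace (ET_space T (\<phi>s ! j) (\<theta>ss ! j))"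
begin

lemma fst_p: "fst p \<in> topspace (little_disks (length (map length \<theta>ss)))"
  using ET_spaceD(1) [OF p] len by simp

lemma fst_q: "j < length (map length \<theta>ss) \<Longrightarrow> fst (q j) \<in> topspace (little_disks (map length \<theta>ss ! j))"
  using ET_spaceD(1) [OF q] len by simp

text \<open>The complement of the composite in decomposed form, so that a statement about the glued
  map can be split into its pieces.\<close>

definition glued_complement :: "'a set" where
  "glued_complement = disk_complement (length \<phi>s) (fst p) \<union>
     (\<Union>j<length \<phi>s. (\<lambda>z. fst p (j, z)) ` disk_complement (length (\<theta>ss ! j)) (fst (q j)))"

lemma disk_complement_comp:
  "disk_complement (sum_list (map length \<theta>ss))
     (little_disks_comp (map length \<theta>ss) (fst p) (\<lambda>j. fst (q j))) = glued_complement"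
  using disk_complement_little_disks_comp [OF fst_p fst_q] len by (simp add: glued_complement_def)

lemma disk_complement_ET_comp:
  "disk_complement (length (concat \<theta>ss)) (fst (ET_comp \<psi> \<phi>s \<theta>ss p q)) = glued_complement"
  using disk_complement_comp by (simp add: ET_comp_def length_concat)

text \<open>If the point also lies in the complement of \<open>f\<close>, then \<open>z\<close> is
  on the unit sphere, where the inner boundary condition of \<open>p\<close> and the outer one of
  \<open>q j\<close> both prescribe the colour \<open>\<phi>s ! j\<close>.\<close>

lemma glue_compatible:
  assumes "j < length \<phi>s" "z \<in> disk_complement (length (\<theta>ss ! j)) (fst (q j))"
    "fst p (j, z) \<in> disk_complement (length \<phi>s) (fst p)"
  shows "snd p (fst p (j, z)) = snd (q j) z"
proof -
  have "z \<in> sphere 0 1"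
    using little_disk_in_complement_iff [OF ET_spaceD(1) [OF p] assms(1)] assms(2,3)
      disk_complement_subset by blast
  then show ?thesis
    using ET_spaceD(3) [OF p assms(1)] ET_spaceD(4) [OF q [OF assms(1)]] by simp
qed

text \<open>For different disks the common point is a point of tangency. It lies on a boundary
  sphere, hence in the complement of \<open>f\<close>, and both values agree with that of \<xi> by
  the preceding lemma. The two colours are never compared directly.\<close>

lemma glue_compatible_inner:
  assumes "j < length \<phi>s" "z \<in> disk_complement (length (\<theta>ss ! j)) (fst (q j))"
    and "l < length \<phi>s" "w \<in> disk_complement (length (\<theta>ss ! l)) (fst (q l))"
    and eq: "fst p (j, z) = fst p (l, w)"
  shows "snd (q j) z = snd (q l) w"
proof (cases "j = l")
  case True
  then show ?thesis
    using little_disk_inj [OF ET_spaceD(1) [OF p] assms(1)] assms disk_complement_subset by blast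
next
  case False
  note f = ET_spaceD(1) [OF p]
  have zw: "z \<in> cball 0 1" "w \<in> cball 0 1"
    using assms(2,4) disk_complement_subset by blast+
  then have "z \<notin> ball 0 1"
    using little_disk_disjoint [OF f assms(3,1) zw(2), of z] eq False by metis
  then have "z \<in> sphere 0 1"
    using zw(1) by simp
  then have "fst p (j, z) \<in> disk_complement (length \<phi>s) (fst p)"
    using little_disk_in_complement_iff [OF f assms(1) zw(1)] by blast
  then show ?thesis
    using glue_compatible [OF assms(1,2)] glue_compatible [OF assms(3,4)] eq by simp
qed

lemma snd_ET_comp:
  assumes "x \<in> glued_complement"
  shows "snd (ET_comp \<psi> \<phi>s \<theta>ss p q) x = (THE t. (x \<in> disk_complement (length \<phi>s) (fst p) \<and> t = snd p x) \<or>
    (\<exists>j<length \<phi>s. \<exists>z\<in>disk_complement (length (\<theta>ss ! j)) (fst (q j)). x = fst p (j, z) \<and> t = snd (q j) z))"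
  using assms disk_complement_comp len
  by (simp add: ET_comp_def glue_maps_def case_prod_beta cong: conj_cong)

lemma ET_comp_outer:
  assumes "x \<in> disk_complement (length \<phi>s) (fst p)"
  shows "snd (ET_comp \<psi> \<phi>s \<theta>ss p q) x = snd p x"
proof -
  have in_complement: "x \<in> glued_complement"
    using assms by (simp add: glued_complement_def)
  show ?thesis
    unfolding snd_ET_comp [OF in_complement]
    using assms glue_compatible by (intro the_equality) auto
qed

lemma ET_comp_inner:
  assumes "j < length \<phi>s" "z \<in> disk_complement (length (\<theta>ss ! j)) (fst (q j))"
  shows "snd (ET_comp \<psi> \<phi>s \<theta>ss p q) (fst p (j, z)) = snd (q j) z"
proof -
  have in_complement: "fst p (j, z) \<in> glued_complement"
    using assms by (auto simp: glued_complement_def)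
  show ?thesis
    unfolding snd_ET_comp [OF in_complement]
  proof (rule the_equality, goal_cases)
    case 1
    show ?case using assms by blast
  next
    case (2 t)
    then show ?case
    proof (elim disjE exE conjE bexE)
      fix l w assume "l < length \<phi>s" "w \<in> disk_complement (length (\<theta>ss ! l)) (fst (q l))"
        "fst p (j, z) = fst p (l, w)" "t = snd (q l) w"
      then show "t = snd (q j) z"
        using glue_compatible_inner [OF assms] by simp
    qed (use glue_compatible [OF assms] in simp)
  qed
qed

lemma ET_comp_extensional: "snd (ET_comp \<psi> \<phi>s \<theta>ss p q) \<in> extensional glued_complement"
  using disk_complement_comp by (simp add: ET_comp_def glue_maps_def case_prod_beta)

text \<open>Uniqueness of the glued map. Each axiom about a composite is proved by showing that the
  other side has the right configuration and restricts to the prescribed pieces.\<close>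

lemma ET_comp_eqI:
  assumes "fst r = little_disks_comp (map length \<theta>ss) (fst p) (\<lambda>j. fst (q j))"
    and "snd r \<in> extensional glued_complement"
    and "\<And>x. x \<in> disk_complement (length \<phi>s) (fst p) \<Longrightarrow> snd r x = snd p x"
    and "\<And>j z. j < length \<phi>s \<Longrightarrow> z \<in> disk_complement (length (\<theta>ss ! j)) (fst (q j)) \<Longrightarrow>
           snd r (fst p (j, z)) = snd (q j) z"
  shows "ET_comp \<psi> \<phi>s \<theta>ss p q = r"
proof (rule prod_eqI)
  show "fst (ET_comp \<psi> \<phi>s \<theta>ss p q) = fst r"
    using assms(1) by (simp add: ET_comp_def)
  show "snd (ET_comp \<psi> \<phi>s \<theta>ss p q) = snd r"
    using ET_comp_extensional assms(2)
  proof (rule extensionalityI)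
    fix x assume "x \<in> glued_complement"
    then show "snd (ET_comp \<psi> \<phi>s \<theta>ss p q) x = snd r x"
      using assms(3,4) ET_comp_outer ET_comp_inner by (auto simp: glued_complement_def)
  qed
qed

lemma fst_ET_comp:
  assumes "j < length \<phi>s" "i < length (\<theta>ss ! j)" "x \<in> cball 0 1"
  shows "fst (ET_comp \<psi> \<phi>s \<theta>ss p q) (block_offset (map length \<theta>ss) j + i, x) = fst p (j, fst (q j) (i, x))"
  using assms len by (simp add: ET_comp_def little_disks_comp_apply)

text \<open>Recovers the inner coordinate of a point known only to lie in the \<open>j\<close>-th
  closed disk. If \<open>z\<close> is interior, no other disk contains the point, so the witness
  from the decomposition is \<open>z\<close> itself; if \<open>z\<close> is on the sphere, it
  belongs to every complement.\<close>

lemma glued_complement_inner: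
  assumes "j < length \<phi>s" "z \<in> cball 0 1" "fst p (j, z) \<in> glued_complement"
  shows "z \<in> disk_complement (length (\<theta>ss ! j)) (fst (q j))"
proof (cases "z \<in> sphere 0 1")
  case True
  then show ?thesis
    using sphere_subset_disk_complement [OF ET_spaceD(1) [OF q [OF assms(1)]]] by blast
next
  case False
  note f = ET_spaceD(1) [OF p]
  have "fst p (j, z) \<notin> disk_complement (length \<phi>s) (fst p)"
    using little_disk_in_complement_iff [OF f assms(1,2)] False by blast
  then obtain l w where l: "l < length \<phi>s" and w: "w \<in> disk_complement (length (\<theta>ss ! l)) (fst (q l))"
    and eq: "fst p (j, z) = fst p (l, w)"
    using assms(3) unfolding glued_complement_def by blast
  have "w \<in> cball 0 1" "z \<in> ball 0 1"
    using w disk_complement_subset False assms(2) by (blast, auto)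
  then have "l = j"
    using little_disk_disjoint [OF f l assms(1)] eq by metis
  then have "z = w"
    using little_disk_inj [OF f assms(1,2) \<open>w \<in> cball 0 1\<close>] eq by simp
  with w \<open>l = j\<close> show ?thesis by simp
qed

text \<open>An inner sphere of the composite is the image under \<open>f\<close> of an inner sphere
  of some \<open>q j\<close>, inside the piece taken from \<open>q j\<close>. The outer sphere lies
  in the piece taken from \<open>p\<close>.\<close>

lemma ET_comp_boundary:
  "\<forall>k<length (concat \<theta>ss). \<forall>z\<in>sphere 0 1.
     snd (ET_comp \<psi> \<phi>s \<theta>ss p q) (fst (ET_comp \<psi> \<phi>s \<theta>ss p q) (k, z)) = (concat \<theta>ss ! k) z"
  "\<forall>z\<in>sphere 0 1. snd (ET_comp \<psi> \<phi>s \<theta>ss p q) z = \<psi> z"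
proof (intro allI impI ballI)
  fix k and z :: 'a assume "k < length (concat \<theta>ss)" and z: "z \<in> sphere 0 1"
  then have "k < sum_list (map length \<theta>ss)"
    by (simp add: length_concat)
  then obtain j i where "j < length (map length \<theta>ss)" "i < map length \<theta>ss ! j"
    and k: "k = block_offset (map length \<theta>ss) j + i"
    by (rule block_offset_cases)
  then have ji: "j < length \<phi>s" "i < length (\<theta>ss ! j)"
    using len by simp_all
  have "z \<in> cball 0 1" using z by auto
  then have "fst (q j) (i, z) \<in> disk_complement (length (\<theta>ss ! j)) (fst (q j))"
    using little_disk_in_complement_iff [OF ET_spaceD(1) [OF q [OF ji(1)]] ji(2)] z by blast
  then show "snd (ET_comp \<psi> \<phi>s \<theta>ss p q) (fst (ET_comp \<psi> \<phi>s \<theta>ss p q) (k, z)) = (concat \<theta>ss ! k) z"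
    using ET_comp_inner [OF ji(1)] ET_spaceD(3) [OF q [OF ji(1)] ji(2) z] ji len \<open>z \<in> cball 0 1\<close>
    unfolding k by (simp add: fst_ET_comp nth_concat_block_offset del: mem_cball_0)
next
  show "\<forall>z\<in>sphere 0 1. snd (ET_comp \<psi> \<phi>s \<theta>ss p q) z = \<psi> z"
    using ET_comp_outer sphere_subset_disk_complement [OF ET_spaceD(1) [OF p]] ET_spaceD(4) [OF p]
    by (metis subsetD)
qed

end

text \<open>Stated for families over an arbitrary \<open>Y\<close>, the form in which continuity
  into these spaces is characterised. The composition map itself is the case where \<open>Y\<close>
  is the product of the operation spaces and the families are its projections.\<close>

lemma continuous_map_ET_comp:
  fixes P :: "'y \<Rightarrow> ('a::euclidean_space) config \<times> ('a \<Rightarrow> 't)"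
  assumes P: "continuous_map Y (ET_space T \<psi> \<phi>s) P"
    and len: "length \<theta>ss = length \<phi>s"
    and Q: "\<And>j. j < length \<phi>s \<Longrightarrow> continuous_map Y (ET_space T (\<phi>s ! j) (\<theta>ss ! j)) (\<lambda>y. Q y j)"
  shows "continuous_map Y (ET_space T \<psi> (concat \<theta>ss)) (\<lambda>y. ET_comp \<psi> \<phi>s \<theta>ss (P y) (Q y))"
proof -
  have composable: "ET_composable T \<psi> \<phi>s \<theta>ss (P y) (Q y)" if "y \<in> topspace Y" for y
    using continuous_map_image_subset_topspace [OF P] continuous_map_image_subset_topspace [OF Q] that len
    by unfold_locales blast+
  have fstP: "continuous_map Y (little_disks (length \<phi>s)) (\<lambda>y. fst (P y))"
    and evP: "continuous_map (complement_bundle (length \<phi>s) Y (\<lambda>y. fst (P y))) T (\<lambda>(y, x). snd (P y) x)"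
    using P unfolding continuous_map_ET_space_iff WT_test_map_iff by blast+
  have fstQ: "continuous_map Y (little_disks (length (\<theta>ss ! j))) (\<lambda>y. fst (Q y j))"
    and evQ: "continuous_map (complement_bundle (length (\<theta>ss ! j)) Y (\<lambda>y. fst (Q y j))) T (\<lambda>(y, x). snd (Q y j) x)"
    if "j < length \<phi>s" for j
    using Q [OF that] unfolding continuous_map_ET_space_iff WT_test_map_iff by blast+
  let ?R = "\<lambda>y. ET_comp \<psi> \<phi>s \<theta>ss (P y) (Q y)"
  have fstR: "continuous_map Y (little_disks (length (concat \<theta>ss))) (\<lambda>y. fst (?R y))"
    using continuous_map_little_disks_comp [of Y "map length \<theta>ss" "\<lambda>y. fst (P y)" "\<lambda>y j. fst (Q y j)"]
      fstP fstQ len by (simp add: ET_comp_def length_concat)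
  let ?X = "complement_bundle (length (concat \<theta>ss)) Y (\<lambda>y. fst (?R y))"
  let ?g = "\<lambda>(y, x). snd (?R y) x"
  let ?c = "\<lambda>j w. disk_centre (fst (P (fst w))) j" and ?a = "\<lambda>j w. disk_radius (fst (P (fst w))) j"
  have topX: "w \<in> topspace ?X \<longleftrightarrow> fst w \<in> topspace Y \<and>
      snd w \<in> ET_composable.glued_complement \<phi>s \<theta>ss (P (fst w)) (Q (fst w))" for w
    using ET_composable.disk_complement_ET_comp [OF composable]
    unfolding topspace_complement_bundle by (cases w) auto
  have point: "continuous_map ?X euclidean snd"
    by (rule continuous_map_into_fulltopology [OF continuous_map_complement_bundle_point])
  have radius: "continuous_map ?X euclideanreal (?a j)" if "j < length \<phi>s" for j
    using continuous_map_compose [OF continuous_map_complement_bundle_base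
        continuous_map_compose [OF fstP continuous_map_disk_radius [OF that]]] by (simp add: o_def)
  have centre: "continuous_map ?X euclidean (?c j)" if "j < length \<phi>s" for j
    using continuous_map_compose [OF continuous_map_complement_bundle_base
        continuous_map_compose [OF fstP continuous_map_disk_centre [OF that]]] by (simp add: o_def)
  \<comment> \<open>\<open>None\<close> stands for the complement of \<open>f\<close>, and
    \<open>Some j\<close> for the part in the \<open>j\<close>-th closed disk. The latter is an
    inequality between continuous functions of centre and radius, which makes it closed in the total
    space over all of \<open>Y\<close>, not just in each fibre.\<close>
  define S where "S i = (case i of None \<Rightarrow> topspace (complement_bundle (length \<phi>s) Y (\<lambda>y. fst (P y)))
      | Some j \<Rightarrow> {w \<in> topspace ?X. ?a j w - norm (snd w - ?c j w) \<in> {0..}})" for i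
  define I where "I = insert None (Some ` {..<length \<phi>s})"
  \<comment> \<open>All pieces carry the same global function, so agreement on overlaps is immediate
    here: the compatibility was spent on the well-definedness of the glued map.\<close>
  have "continuous_map ?X T ?g"
  proof (rule pasting_lemma_closed [where I = I and T = S and f = "\<lambda>_. ?g"])
    show "finite I" by (simp add: I_def)
    have S_None: "S None \<subseteq> topspace ?X"
      unfolding S_def topspace_complement_bundle
      using ET_composable.disk_complement_ET_comp [OF composable]
      by (auto simp: ET_composable.glued_complement_def [OF composable])
    show "closedin ?X (S i)" if i: "i \<in> I" for i
    proof (cases i)
      case None
      have "S None \<subseteq> {(y, x). x \<in> disk_complement (length (concat \<theta>ss)) (fst (?R y))}"
        using S_None unfolding topspace_complement_bundle by auto
      moreover have "closedin (prod_topology Y (top_of_set (cball 0 1))) (S None)"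
        unfolding S_def using closedin_complement_bundle [OF fstP] by simp
      ultimately show ?thesis
        unfolding None complement_bundle_def by (intro closedin_subset_topspace)
    next
      case (Some j)
      then have "j < length \<phi>s" using i by (auto simp: I_def)
      then have "continuous_map ?X euclideanreal (\<lambda>w. ?a j w - norm (snd w - ?c j w))"
        by (intro continuous_intros radius centre point)
      then show ?thesis
        unfolding Some S_def option.case by (rule closedin_continuous_map_preimage) auto
    qed
    show "continuous_map (subtopology ?X (S i)) T ?g" if i: "i \<in> I" for i
    proof (cases i)
      case None
      let ?B = "complement_bundle (length \<phi>s) Y (\<lambda>y. fst (P y))"
      have "continuous_map (subtopology ?X (S None)) ?B (\<lambda>w. (fst w, snd w))"
        using point continuous_map_complement_bundle_base
        by (intro continuous_map_into_complement_bundle continuous_map_from_subtopology)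
           (auto simp: S_def topspace_complement_bundle)
      from continuous_map_compose [OF this evP]
      have "continuous_map (subtopology ?X (S None)) T (\<lambda>w. snd (P (fst w)) (snd w))"
        by (simp add: o_def case_prod_beta')
      then show ?thesis
        unfolding None
      proof (rule continuous_map_eq)
        fix w assume "w \<in> topspace (subtopology ?X (S None))"
        then have "fst w \<in> topspace Y" "snd w \<in> disk_complement (length \<phi>s) (fst (P (fst w)))"
          by (auto simp: S_def topspace_complement_bundle)
        then show "snd (P (fst w)) (snd w) = ?g w"
          using ET_composable.ET_comp_outer [OF composable] by (simp add: case_prod_beta)
      qed
    next
      case (Some j)
      then have j: "j < length \<phi>s" using i by (auto simp: I_def)
      let ?B = "complement_bundle (length (\<theta>ss ! j)) Y (\<lambda>y. fst (Q y j))"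
      \<comment> \<open>The inverse of the \<open>j\<close>-th embedding. It varies continuously
        with the configuration because the radius is positive, and it carries the piece into the
        bundle of complements of \<open>Q y j\<close>.\<close>
      let ?z = "\<lambda>w. (snd w - ?c j w) /\<^sub>R ?a j w"
      have S: "fst w \<in> topspace Y \<and> fst (P (fst w)) (j, ?z w) = snd w \<and>
          ?z w \<in> disk_complement (length (\<theta>ss ! j)) (fst (Q (fst w) j))"
        if w: "w \<in> topspace (subtopology ?X (S (Some j)))" for w
      proof -
        have wX: "w \<in> topspace ?X" and n: "norm (snd w - ?c j w) \<le> ?a j w"
          using w by (auto simp: S_def)
        have y: "fst w \<in> topspace Y" using wX unfolding topX by blast
        note f = ET_spaceD(1) [OF ET_composable.p [OF composable [OF y]]]
        have a: "?a j w > 0"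
          by (rule disk_radius_pos [OF f j])
        have "norm (?z w) = norm (snd w - ?c j w) / ?a j w"
          using a by (simp only: norm_scaleR) (simp add: divide_inverse_commute)
        then have z: "?z w \<in> cball 0 1"
          using a n by simp
        then have eq: "fst (P (fst w)) (j, ?z w) = snd w"
          using little_disk_eq_iff [OF f j z, of "snd w"] by simp
        then show ?thesis
          using ET_composable.glued_complement_inner [OF composable [OF y] j z] y wX
          unfolding topX by simp
      qed
      have scale: "continuous_map (subtopology ?X (S (Some j))) euclideanreal (\<lambda>w. inverse (?a j w))"
        using disk_radius_pos [OF ET_spaceD(1) [OF ET_composable.p [OF composable]] j] S
        by (intro continuous_map_real_inverse continuous_map_from_subtopology radius j) force
      have "continuous_map (subtopology ?X (S (Some j))) euclidean (\<lambda>w. snd w - ?c j w)"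
        by (intro continuous_map_diff continuous_map_from_subtopology point centre j)
      with scale have "continuous_map (subtopology ?X (S (Some j))) euclidean ?z"
        by (rule continuous_map_scaleR)
      then have "continuous_map (subtopology ?X (S (Some j))) ?B (\<lambda>w. (fst w, ?z w))"
      proof (rule continuous_map_into_complement_bundle [rotated])
        show "continuous_map (subtopology ?X (S (Some j))) Y fst"
          by (intro continuous_map_from_subtopology continuous_map_complement_bundle_base)
      qed (use S in simp)
      from continuous_map_compose [OF this evQ [OF j]]
      have "continuous_map (subtopology ?X (S (Some j))) T (\<lambda>w. snd (Q (fst w) j) (?z w))"
        by (simp add: o_def case_prod_beta')
      then show ?thesis
        unfolding Some
      proof (rule continuous_map_eq)
        fix w assume "w \<in> topspace (subtopology ?X (S (Some j)))"
        note S = S [OF this]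
        then show "snd (Q (fst w) j) (?z w) = ?g w"
          using ET_composable.ET_comp_inner [OF composable j, of "fst w" "?z w"] by (simp add: case_prod_beta)
      qed
    qed
    show "\<exists>i. i \<in> I \<and> w \<in> S i \<and> ?g w = ?g w" if w: "w \<in> topspace ?X" for w
    proof (cases "w \<in> S None")
      case True
      then show ?thesis by (auto simp: I_def)
    next
      case False
      have y: "fst w \<in> topspace Y" using w unfolding topX by blast
      note f = ET_spaceD(1) [OF ET_composable.p [OF composable [OF y]]]
      have "snd w \<notin> disk_complement (length \<phi>s) (fst (P (fst w)))"
        using False y unfolding S_def option.case topspace_complement_bundle by (cases w) auto
      then obtain j z where j: "j < length \<phi>s" and z: "z \<in> disk_complement (length (\<theta>ss ! j)) (fst (Q (fst w) j))"
        and eq: "snd w = fst (P (fst w)) (j, z)"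
        using w unfolding topX ET_composable.glued_complement_def [OF composable [OF y]] by blast
      have "z \<in> cball 0 1"
        using z disk_complement_subset by blast
      then have "dist (?c j w) (snd w) = ?a j w * norm z" "norm z \<le> 1"
        unfolding eq using dist_disk_centre [OF f j] by simp_all
      then have "norm (snd w - ?c j w) \<le> ?a j w"
        using disk_radius_pos [OF f j] by (simp add: dist_norm norm_minus_commute mult_left_le)
      with w have "w \<in> S (Some j)"
        by (simp add: S_def)
      with j show ?thesis by (auto simp: I_def)
    qed
  qed auto
  moreover have "snd (?R y) \<in> extensional (disk_complement (length (concat \<theta>ss)) (fst (?R y)))"
    if "y \<in> topspace Y" for y
    using ET_composable.ET_comp_extensional [OF composable [OF that]]
    by (simp add: ET_composable.disk_complement_ET_comp [OF composable [OF that]])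
  ultimately show ?thesis
    unfolding continuous_map_ET_space_iff WT_test_map_iff
    using fstR ET_composable.ET_comp_boundary [OF composable] by blast
qed

text \<open>Continuity for constant families over a one-point space; membership, including
  continuity of the glued map, is contained in it.\<close>

lemma (in ET_composable) ET_comp_in:
  "ET_comp \<psi> \<phi>s \<theta>ss p q \<in> topspace (ET_space T \<psi> (concat \<theta>ss))"
proof -
  have "continuous_map (discrete_topology {()}) (ET_space T \<psi> (concat \<theta>ss)) (\<lambda>_. ET_comp \<psi> \<phi>s \<theta>ss p q)"
    using p q len by (intro continuous_map_ET_comp) auto
  from continuous_map_image_subset_topspace [OF this] show ?thesis
    by simp
qed

section \<open>The operad axioms\<close>

lemma little_disks_config_eqI:
  fixes f g :: "nat \<times> 'a::euclidean_space \<Rightarrow> 'b"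
  assumes "f \<in> extensional ({..<sum_list ns} \<times> cball 0 1)" "g \<in> extensional ({..<sum_list ns} \<times> cball 0 1)"
    and "\<And>j i x. j < length ns \<Longrightarrow> i < ns ! j \<Longrightarrow> x \<in> cball 0 1 \<Longrightarrow>
           f (block_offset ns j + i, x) = g (block_offset ns j + i, x)"
  shows "f = g"
  using assms(1,2)
proof (rule extensionalityI)
  fix kx :: "nat \<times> 'a" assume "kx \<in> {..<sum_list ns} \<times> cball 0 1"
  then obtain k x where "kx = (k, x)" "k < sum_list ns" "x \<in> cball 0 1" by blast
  then show "f kx = g kx"
    using assms(3) by (metis block_offset_cases)
qed

lemma little_disks_comp_extensional:
  "little_disks_comp ns f g \<in> extensional ({..<sum_list ns} \<times> cball 0 1)"
  by (simp add: little_disks_comp_def)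

lemma little_disks_act_extensional:
  "little_disks_act r \<sigma> f \<in> extensional ({..<r} \<times> cball 0 1)"
  by (simp add: little_disks_act_def)

lemma ET_act_id:
  assumes "p \<in> topspace (ET_space T \<psi> \<phi>s)"
  shows "ET_act \<psi> \<phi>s id p = p"
proof -
  have "little_disks_act (length \<phi>s) id (fst p) = fst p"
    using little_disks_act_extensional little_disks_extensional [OF ET_spaceD(1) [OF assms]]
    by (rule extensionalityI) (auto simp: little_disks_act_def)
  then show ?thesis
    by (simp add: ET_act_def case_prod_beta)
qed

lemma ET_act_act:
  assumes "\<tau> permutes {..<length \<phi>s}"
  shows "ET_act \<psi> \<phi>s (\<sigma> \<circ> \<tau>) p = ET_act \<psi> (permute_list \<sigma> \<phi>s) \<tau> (ET_act \<psi> \<phi>s \<sigma> p)"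
proof -
  have "\<tau> k < length \<phi>s" if "k < length \<phi>s" for k
    using permutes_in_image [OF assms] that by blast
  then have "little_disks_act (length \<phi>s) (\<sigma> \<circ> \<tau>) (fst p) =
      little_disks_act (length \<phi>s) \<tau> (little_disks_act (length \<phi>s) \<sigma> (fst p))"
    by (auto simp: little_disks_act_def fun_eq_iff restrict_def)
  then show ?thesis
    by (simp add: ET_act_def case_prod_beta)
qed

text \<open>The complement of the identity configuration is only the unit sphere, where the value of
  \<open>p\<close> is \<psi>. The one inner piece is all of \<open>p\<close>.\<close>

lemma ET_comp_ident_left:
  assumes \<psi>: "\<psi> \<in> sphere_maps T" and p: "p \<in> topspace (ET_space T \<psi> \<phi>s)"
  shows "ET_comp \<psi> [\<psi>] [\<phi>s] (ET_id \<psi>) (\<lambda>j\<in>{..<1}. p) = p"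
proof -
  interpret comp: ET_composable T \<psi> "[\<psi>]" "[\<phi>s]" "ET_id \<psi>" "\<lambda>j\<in>{..<1}. p"
    using ET_id_in [OF \<psi>] p by unfold_locales auto
  have id: "little_disks_id (0, z) = z" if "z \<in> cball 0 1" for z :: 'a
    using that by (simp add: little_disks_id_def)
  \<comment> \<open>One inclusion suffices: a map extensional on a set is extensional on every
    larger one.\<close>
  have C: "disk_complement (length \<phi>s) (fst p) \<subseteq> comp.glued_complement"
  proof
    fix x assume x: "x \<in> disk_complement (length \<phi>s) (fst p)"
    then have "x = fst (ET_id \<psi>) (0, x)"
      using id disk_complement_subset unfolding ET_id_def fst_conv by (metis subsetD)
    with x show "x \<in> comp.glued_complement"
      unfolding comp.glued_complement_def by (auto intro: rev_image_eqI)
  qed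
  show ?thesis
  proof (rule comp.ET_comp_eqI)
    show "fst p = little_disks_comp (map length [\<phi>s]) (fst (ET_id \<psi>)) (\<lambda>j. fst ((\<lambda>j\<in>{..<1}. p) j))"
    proof (rule little_disks_config_eqI [where ns = "map length [\<phi>s]"])
      show "fst p \<in> extensional ({..<sum_list (map length [\<phi>s])} \<times> cball 0 1)"
        using little_disks_extensional [OF ET_spaceD(1) [OF p]] by simp
      fix j i and x :: 'a
      assume ji: "j < length (map length [\<phi>s])" "i < map length [\<phi>s] ! j" and x: "x \<in> cball 0 1"
      then have "fst p (i, x) \<in> cball 0 1"
        using little_disk_in_cball [OF ET_spaceD(1) [OF p]] by simp
      then show "fst p (block_offset (map length [\<phi>s]) j + i, x) =
          little_disks_comp (map length [\<phi>s]) (fst (ET_id \<psi>)) (\<lambda>j. fst ((\<lambda>j\<in>{..<1}. p) j))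
            (block_offset (map length [\<phi>s]) j + i, x)"
        unfolding little_disks_comp_apply [OF ji x] using ji by (simp add: id ET_id_def block_offset_def)
    qed (rule little_disks_comp_extensional)
    show "snd p \<in> extensional comp.glued_complement"
      using ET_spaceD(2) [OF p] C by (auto simp: extensional_def)
    show "snd p x = snd (ET_id \<psi>) x" if "x \<in> disk_complement (length [\<psi>]) (fst (ET_id \<psi>))" for x
      using that ET_spaceD(4) [OF p, of x] by (simp add: ET_id_def disk_complement_id)
    show "snd p (fst (ET_id \<psi>) (j, z)) = snd ((\<lambda>j\<in>{..<1}. p) j) z"
      if "j < length [\<psi>]" "z \<in> disk_complement (length ([\<phi>s] ! j)) (fst ((\<lambda>j\<in>{..<1}. p) j))" for j z
    proof -
      have j: "j = 0" and "z \<in> disk_complement (length \<phi>s) (fst p)"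
        using that by auto
      then have "z \<in> cball 0 1"
        using disk_complement_subset by blast
      then show ?thesis
        unfolding j by (simp add: ET_id_def id)
    qed
  qed
qed

text \<open>Each inserted complement is a unit sphere, placed on an inner sphere of
  \<open>p\<close>. There the boundary condition of \<open>p\<close> already prescribes the inserted
  colour, so gluing adds nothing.\<close>

lemma ET_comp_ident_right:
  assumes \<phi>s: "\<phi>s \<in> lists (sphere_maps T)" and p: "p \<in> topspace (ET_space T \<psi> \<phi>s)"
  shows "ET_comp \<psi> \<phi>s (map (\<lambda>\<phi>. [\<phi>]) \<phi>s) p (\<lambda>j\<in>{..<length \<phi>s}. ET_id (\<phi>s ! j)) = p"
proof -
  let ?q = "\<lambda>j\<in>{..<length \<phi>s}. ET_id (\<phi>s ! j)" and ?ns = "map length (map (\<lambda>\<phi>. [\<phi>]) \<phi>s)"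
  have mem: "\<phi>s ! j \<in> sphere_maps T" if "j < length \<phi>s" for j
    using \<phi>s that by (auto simp: in_lists_conv_set)
  interpret comp: ET_composable T \<psi> \<phi>s "map (\<lambda>\<phi>. [\<phi>]) \<phi>s" p ?q
    using p mem by unfold_locales (auto simp: ET_id_in)
  have ns: "?ns = replicate (length \<phi>s) 1"
    by (rule nth_equalityI) auto
  have sum: "sum_list ?ns = length \<phi>s"
    unfolding ns by (simp only: sum_list_replicate of_nat_id mult_1_right)
  have offset: "block_offset ?ns j = j" if "j < length \<phi>s" for j
    unfolding ns using that by (simp add: block_offset_def sum_list_replicate)
  have sph: "z \<in> sphere 0 1"
    if "j < length \<phi>s" "z \<in> disk_complement (length (map (\<lambda>\<phi>. [\<phi>]) \<phi>s ! j)) (fst (?q j))" for j z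
    using that disk_complement_id [where 'a = 'a] by (simp add: ET_id_def)
  show ?thesis
  proof (rule comp.ET_comp_eqI)
    show "fst p = little_disks_comp ?ns (fst p) (\<lambda>j. fst (?q j))"
    proof (rule little_disks_config_eqI [where ns = ?ns])
      show "fst p \<in> extensional ({..<sum_list ?ns} \<times> cball 0 1)"
        unfolding sum by (rule little_disks_extensional [OF ET_spaceD(1) [OF p]])
      fix j i and x :: 'a
      assume ji: "j < length ?ns" "i < ?ns ! j" and x: "x \<in> cball 0 1"
      then have i: "i = 0" and j: "j < length \<phi>s" by auto
      show "fst p (block_offset ?ns j + i, x) =
          little_disks_comp ?ns (fst p) (\<lambda>j. fst (?q j)) (block_offset ?ns j + i, x)"
        unfolding little_disks_comp_apply [OF ji x] unfolding offset [OF j] i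
        using x j by (simp add: ET_id_def little_disks_id_def)
    qed (rule little_disks_comp_extensional)
    show "snd p \<in> extensional comp.glued_complement"
      using ET_spaceD(2) [OF p] by (auto simp: extensional_def comp.glued_complement_def)
    show "snd p (fst p (j, z)) = snd (?q j) z"
      if "j < length \<phi>s" "z \<in> disk_complement (length (map (\<lambda>\<phi>. [\<phi>]) \<phi>s ! j)) (fst (?q j))" for j z
      using ET_spaceD(3) [OF p that(1) sph [OF that]] that(1) by (simp add: ET_id_def)
  qed (rule refl)
qed

text \<open>Both sides are glued from three kinds of pieces: those of \<open>p\<close>, of the
  \<open>q j\<close> and of the \<open>s k\<close>. The left side is evaluated on them and compared
  with the description of the right side.\<close>

lemma ET_comp_assoc:
  fixes p :: "('a::euclidean_space) config \<times> ('a \<Rightarrow> 't)"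
  assumes p: "p \<in> topspace (ET_space T \<psi> \<phi>s)"
    and len: "length \<theta>ss = length \<phi>s" "map length \<rho>sss = map length \<theta>ss"
    and q: "\<And>j. j < length \<phi>s \<Longrightarrow> q j \<in> topspace (ET_space T (\<phi>s ! j) (\<theta>ss ! j))"
    and s: "\<And>k. k < length (concat \<theta>ss) \<Longrightarrow> s k \<in> topspace (ET_space T (concat \<theta>ss ! k) (concat \<rho>sss ! k))"
  shows "ET_comp \<psi> (concat \<theta>ss) (concat \<rho>sss) (ET_comp \<psi> \<phi>s \<theta>ss p q) s =
    ET_comp \<psi> \<phi>s (map concat \<rho>sss) p
      (\<lambda>j\<in>{..<length \<phi>s}. ET_comp (\<phi>s ! j) (\<theta>ss ! j) (\<rho>sss ! j) (q j)
         (\<lambda>i\<in>{..<length (\<theta>ss ! j)}. s (block_offset (map length \<theta>ss) j + i)))"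
    (is "?L = ET_comp \<psi> \<phi>s (map concat \<rho>sss) p ?r")
proof -
  let ?o = "block_offset (map length \<theta>ss)"
  let ?s = "\<lambda>j. \<lambda>i\<in>{..<length (\<theta>ss ! j)}. s (?o j + i)"
  have len': "length \<rho>sss = length \<phi>s" "\<And>j. j < length \<phi>s \<Longrightarrow> length (\<rho>sss ! j) = length (\<theta>ss ! j)"
    using len map_eq_imp_length_eq [OF len(2)] by (simp_all add: list_eq_iff_nth_eq)
  have offset_less: "?o j + i < length (concat \<theta>ss)" if "j < length \<phi>s" "i < length (\<theta>ss ! j)" for j i
    using block_offset_less [of j "map length \<theta>ss" i] that len(1) by (simp add: length_concat)
  have nth\<theta>: "concat \<theta>ss ! (?o j + i) = \<theta>ss ! j ! i" if "j < length \<phi>s" "i < length (\<theta>ss ! j)" for j i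
    using nth_concat_block_offset [of j \<theta>ss i] that len(1) by simp
  have nth\<rho>: "concat \<rho>sss ! (?o j + i) = \<rho>sss ! j ! i" if "j < length \<phi>s" "i < length (\<theta>ss ! j)" for j i
    using nth_concat_block_offset [of j \<rho>sss i] that len' len(2) by simp
  have lenc: "length (concat \<rho>sss) = length (concat \<theta>ss)"
    using len(2) by (simp add: length_concat)
  interpret pq: ET_composable T \<psi> \<phi>s \<theta>ss p q
    using p len q by unfold_locales
  interpret L: ET_composable T \<psi> "concat \<theta>ss" "concat \<rho>sss" "ET_comp \<psi> \<phi>s \<theta>ss p q" s
    using pq.ET_comp_in lenc s by unfold_locales
  have qs: "ET_composable T (\<phi>s ! j) (\<theta>ss ! j) (\<rho>sss ! j) (q j) (?s j)" if "j < length \<phi>s" for j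
    using q [OF that] len'(2) [OF that] s [OF offset_less [OF that]] nth\<theta> [OF that] nth\<rho> [OF that]
    by unfold_locales simp_all
  have r: "?r j = ET_comp (\<phi>s ! j) (\<theta>ss ! j) (\<rho>sss ! j) (q j) (?s j)" if "j < length \<phi>s" for j
    using that by simp
  have r_in: "?r j \<in> topspace (ET_space T (\<phi>s ! j) (map concat \<rho>sss ! j))" if "j < length \<phi>s" for j
    unfolding r [OF that] using ET_composable.ET_comp_in [OF qs [OF that]] that len' by simp
  interpret R: ET_composable T \<psi> \<phi>s "map concat \<rho>sss" p ?r
    using p r_in len' by unfold_locales simp_all
  let ?ns = "map length (map concat \<rho>sss)"
  have sum: "sum_list (map length (concat \<rho>sss)) = sum_list ?ns"
    by (induction \<rho>sss) (simp_all add: length_concat)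
  have fst_eq: "fst ?L = little_disks_comp ?ns (fst p) (\<lambda>j. fst (?r j))"
  proof (rule little_disks_config_eqI [where ns = ?ns])
    show "fst ?L \<in> extensional ({..<sum_list ?ns} \<times> cball 0 1)"
      unfolding sum [symmetric] ET_comp_def fst_conv by (rule little_disks_comp_extensional)
    fix j k and x :: 'a
    assume jk: "j < length ?ns" "k < ?ns ! j" and x: "x \<in> cball 0 1"
    then have j: "j < length \<phi>s" and "k < sum_list (map length (\<rho>sss ! j))"
      using len' by (simp_all add: length_concat)
    then obtain i l where "i < length (map length (\<rho>sss ! j))" and l: "l < map length (\<rho>sss ! j) ! i"
      and k: "k = block_offset (map length (\<rho>sss ! j)) i + l"
      by (auto elim: block_offset_cases)
    then have i: "i < length (\<theta>ss ! j)" and l: "l < length (\<rho>sss ! j ! i)"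
      using len'(2) [OF j] by simp_all
    have ns: "?ns = map (\<lambda>xss. length (concat xss)) \<rho>sss" by simp
    \<comment> \<open>One input, numbered on the left by the flattened pair (j, i) followed by
      \<open>l\<close>, and on the right by \<open>j\<close> followed by the flattened pair (i,
      l).\<close>
    have "block_offset (map length (concat \<rho>sss)) (?o j + i) + l = block_offset ?ns j + k"
      using block_offset_concat [of j \<rho>sss i] i j len' unfolding ns k len(2) by simp
    then have "fst ?L (block_offset ?ns j + k, x) =
        fst (ET_comp \<psi> \<phi>s \<theta>ss p q) (?o j + i, fst (s (?o j + i)) (l, x))"
      using L.fst_ET_comp [OF offset_less [OF j i] _ x, of l] l nth\<rho> [OF j i] by simp
    also have "\<dots> = fst p (j, fst (q j) (i, fst (s (?o j + i)) (l, x)))"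
      using l nth\<rho> [OF j i] little_disk_in_cball [OF ET_spaceD(1) [OF s [OF offset_less [OF j i]]] _ x]
      by (intro pq.fst_ET_comp j i) simp
    also have "\<dots> = fst p (j, fst (?r j) (k, x))"
      unfolding r [OF j] k using ET_composable.fst_ET_comp [OF qs [OF j] i l x] i by simp
    also have "\<dots> = little_disks_comp ?ns (fst p) (\<lambda>j. fst (?r j)) (block_offset ?ns j + k, x)"
      by (simp only: little_disks_comp_apply [OF jk x])
    finally show "fst ?L (block_offset ?ns j + k, x) =
        little_disks_comp ?ns (fst p) (\<lambda>j. fst (?r j)) (block_offset ?ns j + k, x)" .
  qed (rule little_disks_comp_extensional)
  show ?thesis
  proof (rule R.ET_comp_eqI [symmetric])
    show "fst ?L = little_disks_comp ?ns (fst p) (\<lambda>j. fst (?r j))" by (rule fst_eq)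
    \<comment> \<open>Both are complements of the same configuration, so the two decompositions need
      not be compared piece by piece.\<close>
    have "L.glued_complement = R.glued_complement"
      using L.disk_complement_ET_comp R.disk_complement_comp sum fst_eq by (simp add: length_concat)
    then show "snd ?L \<in> extensional R.glued_complement"
      using L.ET_comp_extensional by simp
    have outer: "snd ?L x = snd (ET_comp \<psi> \<phi>s \<theta>ss p q) x" if "x \<in> pq.glued_complement" for x
      using L.ET_comp_outer that pq.disk_complement_ET_comp by simp
    show "snd ?L x = snd p x" if "x \<in> disk_complement (length \<phi>s) (fst p)" for x
      using outer pq.ET_comp_outer that by (simp add: pq.glued_complement_def)
    fix j z assume j: "j < length \<phi>s" and "z \<in> disk_complement (length (map concat \<rho>sss ! j)) (fst (?r j))"
    then have "z \<in> ET_composable.glued_complement (\<theta>ss ! j) (\<rho>sss ! j) (q j) (?s j)"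
      using ET_composable.disk_complement_ET_comp [OF qs [OF j]] len' by simp
    \<comment> \<open>Inside the \<open>j\<close>-th disk, the right side splits into the piece of
      \<open>q j\<close>, which the left side counts as outer, and the pieces of the operations
      inserted into \<open>q j\<close>.\<close>
    then consider "z \<in> disk_complement (length (\<theta>ss ! j)) (fst (q j))"
      | i w where "i < length (\<theta>ss ! j)" "w \<in> disk_complement (length (\<rho>sss ! j ! i)) (fst (s (?o j + i)))"
          "z = fst (q j) (i, w)"
      unfolding ET_composable.glued_complement_def [OF qs [OF j]] by force
    then show "snd ?L (fst p (j, z)) = snd (?r j) z"
    proof cases
      case 1
      then have "fst p (j, z) \<in> pq.glued_complement"
        using j by (auto simp: pq.glued_complement_def)
      then show ?thesis
        using outer pq.ET_comp_inner [OF j 1] ET_composable.ET_comp_outer [OF qs [OF j] 1] r [OF j] by simp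
    next
      case (2 i w)
      have "w \<in> cball 0 1"
        using 2(2) disk_complement_subset by blast
      then have "fst p (j, z) = fst (ET_comp \<psi> \<phi>s \<theta>ss p q) (?o j + i, w)"
        using pq.fst_ET_comp [OF j 2(1)] 2(3) by simp
      then have "snd ?L (fst p (j, z)) = snd (s (?o j + i)) w"
        using L.ET_comp_inner [OF offset_less [OF j 2(1)]] 2(2) nth\<rho> [OF j 2(1)] by simp
      moreover have "snd (?r j) z = snd (s (?o j + i)) w"
        unfolding r [OF j] 2(3) using ET_composable.ET_comp_inner [OF qs [OF j] 2(1), of w] 2(1,2) by simp
      ultimately show ?thesis by simp
    qed
  qed
qed

text \<open>Permuting the disks of \<open>p\<close> along with the inserted operations only reorders
  the pieces, so the glued maps coincide. The numbering changes: block \<open>j\<close> on the left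
  is block \<open>\<sigma> j\<close> of the original composite.\<close>

lemma ET_comp_act_left:
  fixes p :: "('a::euclidean_space) config \<times> ('a \<Rightarrow> 't)"
  assumes p: "p \<in> topspace (ET_space T \<psi> \<phi>s)"
    and len: "length \<theta>ss = length \<phi>s"
    and \<sigma>: "\<sigma> permutes {..<length \<phi>s}"
    and q: "\<And>j. j < length \<phi>s \<Longrightarrow> q j \<in> topspace (ET_space T (\<phi>s ! j) (\<theta>ss ! j))"
  shows "ET_comp \<psi> (permute_list \<sigma> \<phi>s) (permute_list \<sigma> \<theta>ss) (ET_act \<psi> \<phi>s \<sigma> p) (\<lambda>j\<in>{..<length \<phi>s}. q (\<sigma> j)) =
    ET_act \<psi> (concat \<theta>ss) (block_perm \<sigma> (map length \<theta>ss)) (ET_comp \<psi> \<phi>s \<theta>ss p q)"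
    (is "ET_comp _ _ _ ?p ?q = ?R")
proof -
  have \<sigma>_less: "\<sigma> k < length \<phi>s" if "k < length \<phi>s" for k
    using permutes_in_image [OF \<sigma>] that by blast
  have \<sigma>': "\<sigma> permutes {..<length \<theta>ss}" "\<sigma> permutes {..<length (map length \<theta>ss)}"
    using \<sigma> len by simp_all
  interpret pq: ET_composable T \<psi> \<phi>s \<theta>ss p q
    using p len q by unfold_locales
  have p': "?p \<in> topspace (ET_space T \<psi> (permute_list \<sigma> \<phi>s))"
    using continuous_map_image_subset_topspace [OF continuous_map_ET_act [OF \<sigma>]] p by blast
  interpret L: ET_composable T \<psi> "permute_list \<sigma> \<phi>s" "permute_list \<sigma> \<theta>ss" ?p ?q
    using p' q \<sigma>_less len by unfold_locales (simp_all add: permute_list_nth [OF \<sigma>] permute_list_nth [OF \<sigma>'(1)])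
  have act: "fst ?p (j, z) = fst p (\<sigma> j, z)" if "j < length \<phi>s" "z \<in> cball 0 1" for j z
    using that by (simp add: ET_act_def case_prod_beta little_disks_act_def)
  have C: "disk_complement (length (permute_list \<sigma> \<phi>s)) (fst ?p) = disk_complement (length \<phi>s) (fst p)"
    using disk_complement_little_disks_act [OF \<sigma>] by (simp add: ET_act_def case_prod_beta)
  let ?C = "\<lambda>j. (\<lambda>z. fst p (j, z)) ` disk_complement (length (\<theta>ss ! j)) (fst (q j))"
  have "(\<lambda>z. fst ?p (j, z)) ` disk_complement (length (permute_list \<sigma> \<theta>ss ! j)) (fst (?q j)) = ?C (\<sigma> j)"
    if "j < length \<phi>s" for j
  proof (rule image_cong)
    show "disk_complement (length (permute_list \<sigma> \<theta>ss ! j)) (fst (?q j)) =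
        disk_complement (length (\<theta>ss ! \<sigma> j)) (fst (q (\<sigma> j)))"
      using that len by (simp add: permute_list_nth [OF \<sigma>'(1)])
  qed (use act [OF that] disk_complement_subset in blast)
  then have "(\<Union>j<length \<phi>s. (\<lambda>z. fst ?p (j, z)) ` disk_complement (length (permute_list \<sigma> \<theta>ss ! j)) (fst (?q j))) =
      (\<Union>j\<in>\<sigma> ` {..<length \<phi>s}. ?C j)"
    by simp
  then have glued: "L.glued_complement = pq.glued_complement"
    unfolding L.glued_complement_def pq.glued_complement_def C permutes_image [OF \<sigma>] by simp
  let ?ns = "map length \<theta>ss" and ?ms = "map length (permute_list \<sigma> \<theta>ss)"
  have ms: "?ms = permute_list \<sigma> ?ns"
    using permute_list_map [OF \<sigma>'(1)] by metis
  show ?thesis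
  proof (rule L.ET_comp_eqI)
    show "fst ?R = little_disks_comp ?ms (fst ?p) (\<lambda>j. fst (?q j))"
    proof (rule little_disks_config_eqI [where ns = ?ms])
      show "fst ?R \<in> extensional ({..<sum_list ?ms} \<times> cball 0 1)"
        using little_disks_act_extensional unfolding ms sum_list_permute_list [OF \<sigma>'(2)]
        by (simp add: ET_act_def case_prod_beta length_concat)
      fix j i and x :: 'a
      assume ji: "j < length ?ms" "i < ?ms ! j" and x: "x \<in> cball 0 1"
      then have j: "j < length \<phi>s" and i: "i < length (\<theta>ss ! \<sigma> j)"
        using len by (simp_all add: permute_list_nth [OF \<sigma>'(1)])
      have "block_offset ?ms j + i < length (concat \<theta>ss)"
        using block_offset_less [OF ji] unfolding ms sum_list_permute_list [OF \<sigma>'(2)]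
        by (simp add: length_concat)
      moreover have "block_perm \<sigma> ?ns (block_offset ?ms j + i) = block_offset ?ns (\<sigma> j) + i"
        unfolding ms using block_perm_offset [OF \<sigma>'(2), of j i] i j len \<sigma>_less by simp
      ultimately have "fst ?R (block_offset ?ms j + i, x) =
          fst (ET_comp \<psi> \<phi>s \<theta>ss p q) (block_offset ?ns (\<sigma> j) + i, x)"
        using x by (simp add: ET_act_def case_prod_beta little_disks_act_def)
      also have "\<dots> = fst p (\<sigma> j, fst (q (\<sigma> j)) (i, x))"
        by (rule pq.fst_ET_comp [OF \<sigma>_less [OF j] i x])
      also have "\<dots> = fst ?p (j, fst (?q j) (i, x))"
        using act [OF j little_disk_in_cball [OF ET_spaceD(1) [OF q [OF \<sigma>_less [OF j]]] i x]] j by simp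
      finally show "fst ?R (block_offset ?ms j + i, x) =
          little_disks_comp ?ms (fst ?p) (\<lambda>j. fst (?q j)) (block_offset ?ms j + i, x)"
        by (simp only: little_disks_comp_apply [OF ji x])
    qed (rule little_disks_comp_extensional)
    have R: "snd ?R = snd (ET_comp \<psi> \<phi>s \<theta>ss p q)"
      by (simp add: ET_act_def case_prod_beta)
    show "snd ?R \<in> extensional L.glued_complement"
      unfolding R glued by (rule pq.ET_comp_extensional)
    show "snd ?R x = snd ?p x" if "x \<in> disk_complement (length (permute_list \<sigma> \<phi>s)) (fst ?p)" for x
      using that unfolding C R by (simp add: pq.ET_comp_outer) (simp add: ET_act_def case_prod_beta)
    fix j z assume "j < length (permute_list \<sigma> \<phi>s)"
      and "z \<in> disk_complement (length (permute_list \<sigma> \<theta>ss ! j)) (fst (?q j))"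
    then have j: "j < length \<phi>s" and z: "z \<in> disk_complement (length (\<theta>ss ! \<sigma> j)) (fst (q (\<sigma> j)))"
      using len by (simp_all add: permute_list_nth [OF \<sigma>'(1)])
    have "fst ?p (j, z) = fst p (\<sigma> j, z)"
      using act [OF j] z disk_complement_subset by blast
    then show "snd ?R (fst ?p (j, z)) = snd (?q j) z"
      using pq.ET_comp_inner [OF \<sigma>_less [OF j] z] j unfolding R by simp
  qed
qed

text \<open>Relabelling inside the inserted operations leaves all pieces and all block lengths
  alone. Block offsets are thus unchanged, and only the index within a block moves.\<close>

lemma ET_comp_act_right:
  fixes p :: "('a::euclidean_space) config \<times> ('a \<Rightarrow> 't)"
  assumes p: "p \<in> topspace (ET_space T \<psi> \<phi>s)"
    and len: "length \<theta>ss = length \<phi>s"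
    and \<tau>: "\<And>j. j < length \<phi>s \<Longrightarrow> \<tau> j permutes {..<length (\<theta>ss ! j)}"
    and q: "\<And>j. j < length \<phi>s \<Longrightarrow> q j \<in> topspace (ET_space T (\<phi>s ! j) (\<theta>ss ! j))"
  shows "ET_comp \<psi> \<phi>s (map (\<lambda>j. permute_list (\<tau> j) (\<theta>ss ! j)) [0..<length \<phi>s]) p
      (\<lambda>j\<in>{..<length \<phi>s}. ET_act (\<phi>s ! j) (\<theta>ss ! j) (\<tau> j) (q j)) =
    ET_act \<psi> (concat \<theta>ss) (block_sum_perm \<tau> (map length \<theta>ss)) (ET_comp \<psi> \<phi>s \<theta>ss p q)"
    (is "ET_comp _ _ ?\<theta>ss _ ?q = ?R")
proof -
  interpret pq: ET_composable T \<psi> \<phi>s \<theta>ss p q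
    using p len q by unfold_locales
  have nth: "?\<theta>ss ! j = permute_list (\<tau> j) (\<theta>ss ! j)" and q': "?q j = ET_act (\<phi>s ! j) (\<theta>ss ! j) (\<tau> j) (q j)"
    if "j < length \<phi>s" for j
    using that by simp_all
  have q'_in: "?q j \<in> topspace (ET_space T (\<phi>s ! j) (?\<theta>ss ! j))" if "j < length \<phi>s" for j
    unfolding nth [OF that] q' [OF that]
    using continuous_map_image_subset_topspace [OF continuous_map_ET_act [OF \<tau> [OF that]]] q [OF that] by blast
  interpret L: ET_composable T \<psi> \<phi>s ?\<theta>ss p ?q
    using p q'_in by unfold_locales simp_all
  have C: "disk_complement (length (?\<theta>ss ! j)) (fst (?q j)) = disk_complement (length (\<theta>ss ! j)) (fst (q j))"
    if "j < length \<phi>s" for j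
    unfolding nth [OF that] q' [OF that]
    using disk_complement_little_disks_act [OF \<tau> [OF that]] by (simp add: ET_act_def case_prod_beta)
  then have glued: "L.glued_complement = pq.glued_complement"
    unfolding L.glued_complement_def pq.glued_complement_def by (intro arg_cong2 [where f = "(\<union>)"]) auto
  let ?ns = "map length \<theta>ss"
  have ns: "map length ?\<theta>ss = ?ns"
    using len by (intro nth_equalityI) auto
  have R: "snd ?R = snd (ET_comp \<psi> \<phi>s \<theta>ss p q)"
    by (simp add: ET_act_def case_prod_beta)
  show ?thesis
  proof (rule L.ET_comp_eqI)
    show "fst ?R = little_disks_comp (map length ?\<theta>ss) (fst p) (\<lambda>j. fst (?q j))"
      unfolding ns
    proof (rule little_disks_config_eqI [where ns = ?ns])
      show "fst ?R \<in> extensional ({..<sum_list ?ns} \<times> cball 0 1)"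
        using little_disks_act_extensional by (simp add: ET_act_def case_prod_beta length_concat)
      fix j i and x :: 'a
      assume ji: "j < length ?ns" "i < ?ns ! j" and x: "x \<in> cball 0 1"
      then have j: "j < length \<phi>s" and i: "i < length (\<theta>ss ! j)"
        using len by simp_all
      then have \<tau>i: "\<tau> j i < length (\<theta>ss ! j)"
        using permutes_in_image [OF \<tau> [OF j]] by blast
      have "block_offset ?ns j + i < length (concat \<theta>ss)"
        using block_offset_less [OF ji] by (simp add: length_concat)
      then have "fst ?R (block_offset ?ns j + i, x) =
          fst (ET_comp \<psi> \<phi>s \<theta>ss p q) (block_offset ?ns j + \<tau> j i, x)"
        using x block_sum_perm_offset [OF ji, of \<tau>] by (simp add: ET_act_def case_prod_beta little_disks_act_def)
      also have "\<dots> = fst p (j, fst (q j) (\<tau> j i, x))"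
        by (rule pq.fst_ET_comp [OF j \<tau>i x])
      also have "\<dots> = fst p (j, fst (?q j) (i, x))"
        using x i j by (simp add: ET_act_def case_prod_beta little_disks_act_def)
      finally show "fst ?R (block_offset ?ns j + i, x) =
          little_disks_comp ?ns (fst p) (\<lambda>j. fst (?q j)) (block_offset ?ns j + i, x)"
        by (simp only: little_disks_comp_apply [OF ji x])
    qed (rule little_disks_comp_extensional)
    show "snd ?R \<in> extensional L.glued_complement"
      unfolding R glued by (rule pq.ET_comp_extensional)
    show "snd ?R x = snd p x" if "x \<in> disk_complement (length \<phi>s) (fst p)" for x
      unfolding R using that by (rule pq.ET_comp_outer)
    show "snd ?R (fst p (j, z)) = snd (?q j) z"
      if "j < length \<phi>s" "z \<in> disk_complement (length (?\<theta>ss ! j)) (fst (?q j))" for j z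
    proof -
      have "snd (?q j) z = snd (q j) z"
        using that(1) by (simp add: ET_act_def case_prod_beta)
      then show ?thesis
        using pq.ET_comp_inner [OF that(1)] that(2) unfolding R C [OF that(1)] by simp
    qed
  qed
qed

theorem proposition2p5:
  fixes T :: "'t topology"
  shows "coloured_topological_operad (sphere_maps T :: (real ^ 'n \<Rightarrow> 't) set)
           (ET_space T) ET_id ET_act ET_comp"
proof (unfold_locales, goal_cases)
  case (3 c ds ess)
  let ?Q = "product_topology (\<lambda>j. ET_space T (ds ! j) (ess ! j)) {..<length ds}"
  let ?Y = "prod_topology (ET_space T c ds) ?Q"
  \<comment> \<open>The projections are the families to which the continuity lemma is applied; its
    base is the product topology itself.\<close>
  have "continuous_map ?Y (ET_space T (ds ! j) (ess ! j)) (\<lambda>y. snd y j)" if "j < length ds" for j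
    using continuous_map_compose [OF continuous_map_snd continuous_map_product_projection, of j "{..<length ds}"] that
    by (simp add: o_def)
  then have "continuous_map ?Y (ET_space T c (concat ess)) (\<lambda>y. ET_comp c ds ess (fst y) (snd y))"
    using 3 by (intro continuous_map_ET_comp continuous_map_fst)
  then show ?case
    by (simp add: case_prod_beta')
next
  case (6 c es p)
  from ET_comp_ident_left [OF 6(1,3)] show ?case .
next
  case (8 c ds ess fsss p q s)
  then show ?case
    by (intro ET_comp_assoc [where T = T]) (simp_all add: PiE_iff)
next
  case (9 c ds ess \<sigma> p q)
  then show ?case
    by (intro ET_comp_act_left [where T = T]) (simp_all add: PiE_iff)
next
  case (10 c ds ess \<tau> p q)
  then show ?case
    by (intro ET_comp_act_right [where T = T]) (simp_all add: PiE_iff)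
qed (simp_all add: ET_id_in continuous_map_ET_act ET_act_id ET_act_act
       ET_comp_ident_right [where T = T])

end
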